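(* Let $\mathbb F$ be a field of characteristic different from $2$, and let $J:\alpha\mapsto\alpha^J$ be a fixed non-trivial involutory automorphism of $\mathbb F$. Let $\mathbb V$ be a finite dimensional vector space over $\mathbb F$ of dimension at least $2$, and let $T:\mathbb V\to\mathbb V$ be an invertible linear map. Let $T_o$ be the restriction of $T$ to $\mathbb V_o$, the part of $\mathbb V$ on which $T$ has no eigenvalue $1$ or $-1$ (as defined in the context). Then: (a) $\mathbb V$ admits a $T$-invariant non-degenerate $J$-hermitian form if and only if every elementary divisor of $T_o$ is either self-dual, or its dual is also an elementary divisor of $T_o$ with the same multiplicity. (b) $\mathbb V$ admits a $T$-invariant non-degenerate $J$-skew-hermitian form if and only if every elementary divisor of $T_o$ is either self-dual, or its dual is also an elementary divisor of $T_o$ with the same multiplicity.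
   Context: An involutory automorphism $J$ of $\mathbb F$ is a map $\alpha\mapsto\alpha^J$ with $(\alpha+\beta)^J=\alpha^J+\beta^J$, $(\alpha\beta)^J=\alpha^J\beta^J$, $(\alpha^J)^J=\alpha$; non-trivial means $J$ is not the identity. A $J$-sesquilinear form on $\mathbb V$ is a map $H:\mathbb V\times\mathbb V\to\mathbb F$, additive in each variable, with $H(\alpha u,\beta v)=\alpha^J\beta H(u,v)$. It is $J$-hermitian if $H(u,v)=H(v,u)^J$ for all $u,v$, and $J$-skew-hermitian if $H(u,v)=-H(v,u)^J$ for all $u,v$. It is $T$-invariant if $H(Tu,Tv)=H(u,v)$ for all $u,v\in\mathbb V$. Write the characteristic polynomial of $T$ as $\chi_T(x)=(x-1)^e(x+1)^f\chi_{oT}(x)$ with $e,f\ge 0$ and $\chi_{oT}$ having neither $1$ nor $-1$ as a root. Put $\mathbb V_o=\ker\chi_{oT}(T)$ and $T_o=T|_{\mathbb V_o}$. The elementary divisors of a linear map are the prime powers $p(x)^k$ ($p$ monic irreducible over $\mathbb F$) occurring when the space is decomposed into a direct sum of indecomposable invariant subspaces, each isomorphic, with the action of the map, to $\mathbb F[x]/(p(x)^k)$ with multiplication by $x$. The multiplicity of the elementary divisor $p(x)^k$ is the number of times it occurs in this decomposition. For a monic polynomial $f(x)=\sum_{i=0}^d a_ix^i$ over $\mathbb F$ ($a_d=1$) not having $-1,0,1$ as roots, its dual is $f^*(x)=(f(0)^J)^{-1}x^d f^J(x^{-1})=\frac{1}{a_0^J}\sum_{i=0}^d a_{d-i}^J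 x^i$, where $f^J(x)=\sum_{i=0}^d a_i^Jx^i$. The polynomial $f$ is self-dual if $f=f^*$. *)

theory Defs
  imports Jordan_Normal_Form.Char_Poly "HOL-Computational_Algebra.Computational_Algebra"
begin

definition involutory_automorphism :: "('a::field \<Rightarrow> 'a) \<Rightarrow> bool" where
  "involutory_automorphism J \<longleftrightarrow>
     (\<forall>a b. J (a + b) = J a + J b) \<and> (\<forall>a b. J (a * b) = J a * J b) \<and> (\<forall>a. J (J a) = a)"

text \<open>Vector spaces are given by a scalar multiplication \<open>scale\<close> on a whole type, as in
  \<open>HOL.Vector_Spaces\<close>.\<close>

definition sesquilinear_form ::
    "('a::field \<Rightarrow> 'b::ab_group_add \<Rightarrow> 'b) \<Rightarrow> ('a \<Rightarrow> 'a) \<Rightarrow> ('b \<Rightarrow> 'b \<Rightarrow> 'a) \<Rightarrow> bool" where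
  "sesquilinear_form scale J H \<longleftrightarrow>
     (\<forall>u u' v. H (u + u') v = H u v + H u' v) \<and>
     (\<forall>u v v'. H u (v + v') = H u v + H u v') \<and>
     (\<forall>a b u v. H (scale a u) (scale b v) = J a * b * H u v)"

definition hermitian_form ::
    "('a::field \<Rightarrow> 'b::ab_group_add \<Rightarrow> 'b) \<Rightarrow> ('a \<Rightarrow> 'a) \<Rightarrow> ('b \<Rightarrow> 'b \<Rightarrow> 'a) \<Rightarrow> bool" where
  "hermitian_form scale J H \<longleftrightarrow>
     sesquilinear_form scale J H \<and> (\<forall>u v. H u v = J (H v u))"

definition skew_hermitian_form ::
    "('a::field \<Rightarrow> 'b::ab_group_add \<Rightarrow> 'b) \<Rightarrow> ('a \<Rightarrow> 'a) \<Rightarrow> ('b \<Rightarrow> 'b \<Rightarrow> 'a) \<Rightarrow> bool" where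
  "skew_hermitian_form scale J H \<longleftrightarrow>
     sesquilinear_form scale J H \<and> (\<forall>u v. H u v = - J (H v u))"

definition nondegenerate_form :: "('b::zero \<Rightarrow> 'b \<Rightarrow> 'a::zero) \<Rightarrow> bool" where
  "nondegenerate_form H \<longleftrightarrow>
     (\<forall>u. (\<forall>v. H u v = 0) \<longrightarrow> u = 0) \<and> (\<forall>v. (\<forall>u. H u v = 0) \<longrightarrow> v = 0)"

definition invariant_form :: "('b \<Rightarrow> 'b) \<Rightarrow> ('b \<Rightarrow> 'b \<Rightarrow> 'a) \<Rightarrow> bool" where
  "invariant_form T H \<longleftrightarrow> (\<forall>u v. H (T u) (T v) = H u v)"

definition is_basis_list ::
    "('a::field \<Rightarrow> 'b::ab_group_add \<Rightarrow> 'b) \<Rightarrow> 'b list \<Rightarrow> bool" where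
  "is_basis_list scale bs \<longleftrightarrow>
     distinct bs \<and> \<not> module.dependent scale (set bs) \<and> module.span scale (set bs) = UNIV"

definition matrix_of ::
    "('a::field \<Rightarrow> 'b::ab_group_add \<Rightarrow> 'b) \<Rightarrow> 'b list \<Rightarrow> ('b \<Rightarrow> 'b) \<Rightarrow> 'a mat" where
  "matrix_of scale bs T =
     mat (length bs) (length bs) (\<lambda>(i, j). module.representation scale (set bs) (T (bs ! j)) (bs ! i))"

text \<open>The characteristic polynomial of a linear map does not depend on the chosen basis.\<close>

definition char_poly_of ::
    "('a::field \<Rightarrow> 'b::ab_group_add \<Rightarrow> 'b) \<Rightarrow> ('b \<Rightarrow> 'b) \<Rightarrow> 'a poly" where
  "char_poly_of scale T = char_poly (matrix_of scale (SOME bs. is_basis_list scale bs) T)"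

definition char_poly_o ::
    "('a::field \<Rightarrow> 'b::ab_group_add \<Rightarrow> 'b) \<Rightarrow> ('b \<Rightarrow> 'b) \<Rightarrow> 'a poly" where
  "char_poly_o scale T =
     (let \<chi> = char_poly_of scale T
      in \<chi> div ([:-1, 1:] ^ Polynomial.order 1 \<chi> * [:1, 1:] ^ Polynomial.order (-1) \<chi>))"

definition apply_poly ::
    "('a::field \<Rightarrow> 'b::ab_group_add \<Rightarrow> 'b) \<Rightarrow> 'a poly \<Rightarrow> ('b \<Rightarrow> 'b) \<Rightarrow> 'b \<Rightarrow> 'b" where
  "apply_poly scale p T v = (\<Sum>i\<le>Polynomial.degree p. scale (Polynomial.coeff p i) ((T ^^ i) v))"

definition V_o :: "('a::field \<Rightarrow> 'b::ab_group_add \<Rightarrow> 'b) \<Rightarrow> ('b \<Rightarrow> 'b) \<Rightarrow> 'b set" where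
  "V_o scale T = {v. apply_poly scale (char_poly_o scale T) T v = 0}"

definition invariant_subspace ::
    "('a::field \<Rightarrow> 'b::ab_group_add \<Rightarrow> 'b) \<Rightarrow> ('b \<Rightarrow> 'b) \<Rightarrow> 'b set \<Rightarrow> bool" where
  "invariant_subspace scale T W \<longleftrightarrow> module.subspace scale W \<and> T ` W \<subseteq> W"

definition direct_sum :: "nat \<Rightarrow> (nat \<Rightarrow> 'b::ab_group_add set) \<Rightarrow> 'b set \<Rightarrow> bool" where
  "direct_sum m U W \<longleftrightarrow>
     W = {\<Sum>i<m. w i | w. \<forall>i<m. w i \<in> U i} \<and>
     (\<forall>w. (\<forall>i<m. w i \<in> U i) \<and> (\<Sum>i<m. w i) = 0 \<longrightarrow> (\<forall>i<m. w i = 0))"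

definition indecomposable ::
    "('a::field \<Rightarrow> 'b::ab_group_add \<Rightarrow> 'b) \<Rightarrow> ('b \<Rightarrow> 'b) \<Rightarrow> 'b set \<Rightarrow> bool" where
  "indecomposable scale T W \<longleftrightarrow>
     invariant_subspace scale T W \<and> W \<noteq> {0} \<and>
     (\<forall>A B. invariant_subspace scale T A \<and> invariant_subspace scale T B \<and>
        A \<inter> B = {0} \<and> {a + b | a b. a \<in> A \<and> b \<in> B} = W \<longrightarrow> A = {0} \<or> B = {0})"

text \<open>\<open>W\<close>, with the action of \<open>T\<close>, is isomorphic to \<open>F[x]/(q)\<close> with multiplication by \<open>x\<close>.
  The quotient is modelled by its canonical representatives, the polynomials reduced modulo
  \<open>q\<close>; these are closed under addition and scalar multiplication.\<close>

definition isomorphic_to_quotient ::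
    "('a::field \<Rightarrow> 'b::ab_group_add \<Rightarrow> 'b) \<Rightarrow> ('b \<Rightarrow> 'b) \<Rightarrow> 'b set \<Rightarrow> 'a poly \<Rightarrow> bool" where
  "isomorphic_to_quotient scale T W q \<longleftrightarrow>
     (let R = {g. g mod q = g} in
      \<exists>\<phi>. bij_betw \<phi> R W \<and>
        (\<forall>g\<in>R. \<forall>h\<in>R. \<phi> (g + h) = \<phi> g + \<phi> h) \<and>
        (\<forall>c. \<forall>g\<in>R. \<phi> (Polynomial.smult c g) = scale c (\<phi> g)) \<and>
        (\<forall>g\<in>R. \<phi> (([:0, 1:] * g) mod q) = T (\<phi> g)))"

text \<open>The family of elementary divisors of the restriction of \<open>T\<close> to an invariant subspace \<open>W\<close>,
  read off from a decomposition of \<open>W\<close>; only the values of \<open>T\<close> on \<open>W\<close> matter.\<close>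

definition is_elementary_divisors ::
    "('a::field \<Rightarrow> 'b::ab_group_add \<Rightarrow> 'b) \<Rightarrow> ('b \<Rightarrow> 'b) \<Rightarrow> 'b set \<Rightarrow> 'a poly multiset \<Rightarrow> bool" where
  "is_elementary_divisors scale T W M \<longleftrightarrow>
     (\<exists>m U p k. direct_sum m U W \<and>
        (\<forall>i<m. indecomposable scale T (U i) \<and>
           lead_coeff (p i) = 1 \<and> Factorial_Ring.irreducible (p i) \<and> 0 < k i \<and>
           isomorphic_to_quotient scale T (U i) (p i ^ k i)) \<and>
        M = image_mset (\<lambda>i. p i ^ k i) (mset_set {..<m}))"

text \<open>By uniqueness of the primary cyclic decomposition, the multiset does not depend on the
  decomposition; the multiplicity of an elementary divisor is its \<open>count\<close>.\<close>

definition elementary_divisors ::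
    "('a::field \<Rightarrow> 'b::ab_group_add \<Rightarrow> 'b) \<Rightarrow> ('b \<Rightarrow> 'b) \<Rightarrow> 'b set \<Rightarrow> 'a poly multiset" where
  "elementary_divisors scale T W = (SOME M. is_elementary_divisors scale T W M)"

text \<open>\<open>reflect_poly g\<close> is \<open>x^d g(1/x)\<close>, where \<open>d\<close> is the degree of \<open>g\<close>. The notion is meant for
  monic \<open>f\<close> without the roots \<open>-1\<close>, \<open>0\<close>, \<open>1\<close>.\<close>

definition dual_poly :: "('a::field \<Rightarrow> 'a) \<Rightarrow> 'a poly \<Rightarrow> 'a poly" where
  "dual_poly J f = Polynomial.smult (inverse (J (poly f 0))) (reflect_poly (map_poly J f))"

definition self_dual :: "('a::field \<Rightarrow> 'a) \<Rightarrow> 'a poly \<Rightarrow> bool" where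
  "self_dual J f \<longleftrightarrow> dual_poly J f = f"

definition elementary_divisors_closed_under_dual ::
    "('a::field \<Rightarrow> 'a) \<Rightarrow> 'a poly multiset \<Rightarrow> bool" where
  "elementary_divisors_closed_under_dual J M \<longleftrightarrow>
     (\<forall>q. q \<in># M \<longrightarrow>
        self_dual J q \<or> (dual_poly J q \<in># M \<and> count M (dual_poly J q) = count M q))"

end

theory Submission
  imports Defs
begin

text \<open>
  Let \<open>F[x]\<close> act on the space through \<open>T\<close>. The dual \<open>f\<^sup>*\<close> of a polynomial is, up to a
  nonzero scalar and a power of \<open>T\<close>, the adjoint of \<open>f(T)\<close> for every \<open>T\<close>-invariant
  \<open>J\<close>-sesquilinear form \<open>H\<close>: moving \<open>T\<close> from the left argument of \<open>H\<close> to the right one turns it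
  into \<open>T\<^sup>-\<^sup>1\<close> and applies \<open>J\<close> to the coefficients (\<open>sesquilinear_form_act\<close>,
  \<open>adj_eq_0_iff\<close>).

  The condition is necessary because the kernel of an adjoint is the orthogonal complement of an
  image. For non-degenerate \<open>H\<close> this gives \<open>dim ker f(T) = dim ker f\<^sup>*(T)\<close> whenever
  \<open>f(0) \<noteq> 0\<close>. The multiplicity of \<open>p\<^sup>k\<close> is a second difference of the dimensions of
  \<open>ker p(T)\<^sup>j\<close>, divided by the degree of \<open>p\<close> (\<open>primary_decomp_multiplicity\<close>), so \<open>p\<^sup>k\<close>
  and its dual have the same multiplicity (\<open>form_imp_closed_under_dual\<close>). In particular the
  multiset does not depend on the decomposition, and any decomposition may be used.

  The condition is sufficient because the space can be cut into a direct sum of pieces that carry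
  a form. If \<open>U\<close> and \<open>U'\<close> are cyclic with elementary divisors \<open>q\<close> and \<open>q\<^sup>*\<close>, and \<open>v\<close> generates
  \<open>U\<close>, then \<open>B(g v, y) = \<ell>(g(T)\<^sup>\<dagger> y)\<close>, where \<open>\<dagger>\<close> denotes the adjoint, is an invariant
  pairing of \<open>U\<close> with \<open>U'\<close> for every linear functional \<open>\<ell>\<close>. A
  cyclic space of prime power order has a unique minimal invariant subspace, and \<open>B\<close> is
  non-degenerate as soon as \<open>\<ell>\<close> does not vanish on that of \<open>U'\<close> (\<open>pairing_exists\<close>). If
  \<open>q \<noteq> q\<^sup>*\<close>, such a \<open>B\<close> makes \<open>U \<oplus> U'\<close> a hyperbolic space. If \<open>q = q\<^sup>*\<close> and \<open>U = U'\<close>, then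
  \<open>B\<close> or \<open>c B\<close>, with \<open>c\<^sup>J = - c \<noteq> 0\<close>, has a non-degenerate hermitian symmetrization
  (\<open>self_pairing_imp_hermitian\<close>); the existence of \<open>c\<close> rests on the non-triviality of
  \<open>J\<close>, and the argument divides by \<open>2\<close>. The same \<open>c\<close> turns hermitian forms into skew-hermitian ones.

  The eigenvalues \<open>1\<close> and \<open>-1\<close> cause no obstruction: a complement of \<open>V\<^sub>o\<close> has only the elementary
  divisors \<open>(x - 1)\<^sup>k\<close> and \<open>(x + 1)\<^sup>k\<close>, which are self-dual, so the condition on \<open>V\<^sub>o\<close> is equivalent
  to the same condition on the whole space (\<open>closed_under_dual_V_o\<close>).

  Elementary divisors exist by splitting off cyclic summands one at a time
  (\<open>primary_cyclic_complement\<close>). Again a functional that does not vanish on the minimal subspace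
  does the work, this time in defining the complement.
\<close>

section \<open>Divisibility of polynomials over a field\<close>

text \<open>A nonzero element of least degree divides every other one, since otherwise the remainder would be
  a smaller element. It is applied to the combinations of two polynomials and to the polynomials
  that annihilate a subspace.\<close>

lemma poly_ideal_generator:
  fixes I :: "'a::field poly set"
  assumes "f \<in> I" "f \<noteq> 0"
    and add: "\<And>g h. g \<in> I \<Longrightarrow> h \<in> I \<Longrightarrow> g + h \<in> I"
    and mult: "\<And>g h. h \<in> I \<Longrightarrow> g * h \<in> I"
  obtains d where "d \<in> I" "d \<noteq> 0" "\<forall>g\<in>I. d dvd g"
proof -
  obtain d where d: "d \<in> I" "d \<noteq> 0"
    and least: "\<And>g. g \<in> I \<Longrightarrow> g \<noteq> 0 \<Longrightarrow> degree d \<le> degree g"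
    using ex_has_least_nat[of "\<lambda>g. g \<in> I \<and> g \<noteq> 0" f degree] assms(1,2) by metis
  have "d dvd g" if "g \<in> I" for g
  proof -
    have "g mod d = g + (- (g div d)) * d"
      by (simp add: minus_div_mult_eq_mod [symmetric])
    then have "g mod d \<in> I"
      using add mult d(1) that by metis
    then have "g mod d = 0"
      using least[of "g mod d"] degree_mod_less[of d g] d(2) by fastforce
    then show ?thesis by auto
  qed
  then show thesis using that d by blast
qed

lemma coprime_poly_bezout:
  fixes f g :: "'a::field poly"
  assumes "coprime f g"
  obtains s t where "s * f + t * g = 1"
proof -
  define I where "I = {s * f + t * g | s t. True}"
  have "f \<noteq> 0 \<or> g \<noteq> 0"
    using assms by (cases "f = 0") auto
  moreover have "f \<in> I"
    unfolding I_def mem_Collect_eq by (rule exI[of _ 1], rule exI[of _ 0]) simp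
  moreover have "g \<in> I"
    unfolding I_def mem_Collect_eq by (rule exI[of _ 0], rule exI[of _ 1]) simp
  ultimately obtain h where h: "h \<in> I" "h \<noteq> 0" by blast
  have add: "a + b \<in> I" if ab: "a \<in> I" "b \<in> I" for a b
  proof -
    obtain s t s' t' where "a = s * f + t * g" "b = s' * f + t' * g"
      using ab unfolding I_def by blast
    then have "a + b = (s + s') * f + (t + t') * g" by (simp add: algebra_simps)
    then show ?thesis unfolding I_def by blast
  qed
  have mult: "a * b \<in> I" if b: "b \<in> I" for a b
  proof -
    obtain s t where "b = s * f + t * g"
      using b unfolding I_def by blast
    then have "a * b = (a * s) * f + (a * t) * g" by (simp add: algebra_simps)
    then show ?thesis unfolding I_def by blast
  qed
  obtain d where d: "d \<in> I" "d \<noteq> 0" "\<forall>g\<in>I. d dvd g"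
    by (rule poly_ideal_generator[OF h add mult])
  have "is_unit d"
    using coprime_common_divisor[OF assms d(3)[rule_format] d(3)[rule_format]] \<open>f \<in> I\<close> \<open>g \<in> I\<close> by blast
  then obtain e where "1 = d * e" unfolding dvd_def by blast
  then have "1 = e * d" by (metis mult.commute)
  moreover have "e * d \<in> I" by (rule mult[OF d(1)])
  ultimately have "1 \<in> I" by metis
  then obtain s t where "1 = s * f + t * g" unfolding I_def by blast
  then show thesis using that[of s t] by simp
qed

text \<open>An irreducible \<open>p\<close> that does not divide \<open>h\<close> is coprime to it. Inverting \<open>h\<close> modulo \<open>p\<close> in this way
  drives the arguments about vectors of prime power order.\<close>

lemma irreducible_poly_bezout:
  fixes p h :: "'a::field poly"
  assumes "irreducible p" "\<not> p dvd h"
  obtains s t where "s * p + t * h = 1"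
proof -
  have "coprime p h"
  proof (rule coprimeI)
    fix d assume "d dvd p" "d dvd h"
    then obtain c where c: "p = d * c" unfolding dvd_def by blast
    then consider "is_unit d" | "is_unit c" using irreducibleD[OF assms(1) c] by blast
    then show "is_unit d"
    proof cases
      case 2
      then have "p dvd d" using c by (simp add: mult_unit_dvd_iff)
      then show ?thesis using assms(2) \<open>d dvd h\<close> dvd_trans by blast
    qed
  qed
  then show thesis by (rule coprime_poly_bezout) (rule that)
qed

lemma irreducible_poly_degree_pos: "irreducible (p::'a::field poly) \<Longrightarrow> 0 < degree p"
  by (auto simp: irreducible_def is_unit_iff_degree intro: gr0I)

lemma prime_power_part:
  fixes p g :: "'a::field poly"
  assumes "0 < degree p" "g \<noteq> 0"
  obtains a h where "g = p ^ a * h" "\<not> p dvd h"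
  using assms(2)
proof (induction "degree g" arbitrary: g thesis rule: less_induct)
  case less
  show ?case
  proof (cases "p dvd g")
    case True
    then obtain h where h: "g = p * h" unfolding dvd_def by blast
    then have "h \<noteq> 0" "p \<noteq> 0" using less.prems by auto
    then have "degree h < degree g" using h assms(1) by (simp add: degree_mult_eq)
    then obtain a h' where "h = p ^ a * h'" "\<not> p dvd h'"
      by (rule less.hyps[OF _ _ \<open>h \<noteq> 0\<close>])
    then show ?thesis using less.prems(1)[of "Suc a" h'] h by (simp add: mult.assoc)
  next
    case False
    then show ?thesis using less.prems(1)[of 0 g] by simp
  qed
qed

lemma monic_irreducible_dvd_eq:
  fixes p q :: "'a::field poly"
  assumes "irreducible p" "monic p" "irreducible q" "monic q" "p dvd q"
  shows "p = q"
proof -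
  obtain c where c: "q = p * c" using assms(5) unfolding dvd_def by blast
  have "is_unit c"
    using irreducibleD[OF assms(3) c] assms(1) by (auto simp: irreducible_def)
  then obtain a where "c = [:a:]" by (metis degree_eq_zeroE is_unit_iff_degree not_is_unit_0)
  then show ?thesis using c assms(2,4) by (cases "a = 0") auto
qed

lemma monic_irreducible_power_dvd_eq:
  fixes p q :: "'a::field poly"
  assumes "irreducible p" "monic p" "irreducible q" "monic q" "p dvd q ^ n"
  shows "p = q"
  using monic_irreducible_dvd_eq[OF assms(1-4)] assms(5)
    prime_elem_dvd_power[OF field_poly_irreducible_imp_prime[OF assms(1)]] by blast

lemma monic_irreducible_power_eq_iff:
  fixes p q :: "'a::field poly"
  assumes "irreducible p" "monic p" "irreducible q" "monic q" "0 < k"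
  shows "p ^ k = q ^ l \<longleftrightarrow> p = q \<and> k = l"
proof
  assume eq: "p ^ k = q ^ l"
  then have "p dvd q ^ l" using dvd_power[of k p] assms(5) by simp
  then have "p = q" using monic_irreducible_power_dvd_eq assms by metis
  moreover have "p \<noteq> 0" using assms(1) by auto
  ultimately have "k * degree p = l * degree p"
    using arg_cong[OF eq, of degree] by (simp add: degree_power_eq)
  then show "p = q \<and> k = l"
    using irreducible_poly_degree_pos[OF assms(1)] \<open>p = q\<close> by simp
qed auto

section \<open>The action of polynomials\<close>

locale linear_endo =
  finite_dimensional_vector_space scale Basis
  for scale :: "'a::field \<Rightarrow> 'b::ab_group_add \<Rightarrow> 'b" (infixr \<open>*s\<close> 75)
    and Basis :: "'b set" +
  fixes T :: "'b \<Rightarrow> 'b"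
  assumes linear_T: "Vector_Spaces.linear scale scale T"
begin

lemma T_add: "T (u + v) = T u + T v"
  and T_scale: "T (c *s v) = c *s T v"
  and T_zero: "T 0 = 0"
proof -
  interpret T: Vector_Spaces.linear scale scale T by (rule linear_T)
  show "T (u + v) = T u + T v" "T (c *s v) = c *s T v" "T 0 = 0"
    by (rule T.add T.scale T.zero)+
qed

lemma T_sum: "T (sum f A) = (\<Sum>a\<in>A. T (f a))"
  by (induction A rule: infinite_finite_induct) (auto simp: T_zero T_add)

abbreviation act :: "'a poly \<Rightarrow> 'b \<Rightarrow> 'b" (infixr \<open>\<star>\<close> 75)
  where "g \<star> v \<equiv> apply_poly scale g T v"

lemma act_bound:
  assumes "degree g \<le> n"
  shows "g \<star> v = (\<Sum>i\<le>n. coeff g i *s (T ^^ i) v)"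
  unfolding apply_poly_def using assms
  by (intro sum.mono_neutral_left) (auto simp: coeff_eq_0)

lemma act_pCons: "pCons a g \<star> v = a *s v + T (g \<star> v)"
proof -
  have "pCons a g \<star> v = (\<Sum>i\<le>Suc (degree g). coeff (pCons a g) i *s (T ^^ i) v)"
    by (intro act_bound) (simp add: degree_pCons_le)
  also have "\<dots> = a *s v + (\<Sum>i\<le>degree g. coeff g i *s T ((T ^^ i) v))"
    by (subst sum.atMost_Suc_shift) simp
  also have "\<dots> = a *s v + T (g \<star> v)"
    unfolding apply_poly_def by (simp add: T_sum T_scale)
  finally show ?thesis .
qed

lemma act_0_left [simp]: "0 \<star> v = 0"
  by (simp add: apply_poly_def)

lemma act_1 [simp]: "1 \<star> v = v"
  using act_pCons[of 1 0 v] by (simp add: one_pCons T_zero)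

lemma act_x: "[:0, 1:] \<star> v = T v"
  by (simp add: act_pCons T_zero)

lemma act_add_left: "(g + h) \<star> v = g \<star> v + h \<star> v"
  by (simp add: act_bound[of _ "max (degree g) (degree h)"] degree_add_le scale_left_distrib sum.distrib)

lemma act_smult: "Polynomial.smult c g \<star> v = c *s (g \<star> v)"
  by (simp add: act_bound[of _ "degree g"] degree_smult_le scale_sum_right)

lemma act_add_right: "g \<star> (u + v) = g \<star> u + g \<star> v"
  by (induction g) (simp_all add: act_pCons T_add scale_right_distrib)

lemma act_scale: "g \<star> (c *s v) = c *s (g \<star> v)"
  by (induction g) (simp_all add: act_pCons T_scale scale_right_distrib scale_left_commute)

lemma act_0_right [simp]: "g \<star> 0 = 0"
  using act_scale[of g 0 0] by simp

lemma act_mult: "(g * h) \<star> v = g \<star> h \<star> v"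
  by (induction g) (simp_all add: act_pCons act_add_left act_smult)

lemma act_commute: "g \<star> h \<star> v = h \<star> g \<star> v"
  by (metis act_mult mult.commute)

lemma act_T: "g \<star> T v = T (g \<star> v)"
  by (metis act_commute act_x)

lemma act_uminus_left: "(- g) \<star> v = - (g \<star> v)"
  using act_smult[of "-1" g v] by (simp add: scale_minus_left)

lemma act_diff_left: "(g - h) \<star> v = g \<star> v - h \<star> v"
  using act_add_left[of g "-h" v] by (simp add: act_uminus_left)

lemma act_sum_left: "sum f A \<star> v = (\<Sum>a\<in>A. f a \<star> v)"
  by (induction A rule: infinite_finite_induct) (auto simp: act_add_left)

lemma act_sum_right: "g \<star> sum f A = (\<Sum>a\<in>A. g \<star> f a)"
  by (induction A rule: infinite_finite_induct) (auto simp: act_add_right)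

lemma act_monom: "monom c i \<star> v = c *s (T ^^ i) v"
  by (simp add: act_bound[of _ i] degree_monom_le sum.remove[of "{..i}" i])

abbreviation invariant :: "'b set \<Rightarrow> bool"
  where "invariant W \<equiv> invariant_subspace scale T W"

lemma invariant_subspaceD: "invariant W \<Longrightarrow> subspace W"
  by (simp add: invariant_subspace_def)

lemma invariant_act: "invariant W \<Longrightarrow> v \<in> W \<Longrightarrow> g \<star> v \<in> W"
  by (induction g)
    (auto simp: act_pCons invariant_subspace_def subspace_0 intro!: subspace_add subspace_scale)

lemma invariantI:
  assumes "0 \<in> W" "\<And>u v. u \<in> W \<Longrightarrow> v \<in> W \<Longrightarrow> u + v \<in> W" "\<And>g v. v \<in> W \<Longrightarrow> g \<star> v \<in> W"
  shows "invariant W"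
  unfolding invariant_subspace_def
proof
  show "subspace W"
  proof (rule subspaceI)
    show "c *s v \<in> W" if "v \<in> W" for c v
      using assms(3)[OF that, of "[:c:]"] by (simp add: act_pCons T_zero)
  qed (use assms in auto)
  show "T ` W \<subseteq> W"
    using assms(3)[of _ "[:0,1:]"] by (auto simp: act_x)
qed

end

section \<open>Cyclic subspaces and the Cayley-Hamilton theorem\<close>

context linear_endo begin

abbreviation cyc :: "'b \<Rightarrow> 'b set"
  where "cyc v \<equiv> range (\<lambda>g. g \<star> v)"

definition has_order :: "'b \<Rightarrow> 'a poly \<Rightarrow> bool"
  where "has_order v q \<longleftrightarrow> (\<forall>g. g \<star> v = 0 \<longleftrightarrow> q dvd g)"

lemma has_orderD: "has_order v q \<Longrightarrow> g \<star> v = 0 \<longleftrightarrow> q dvd g"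
  by (simp add: has_order_def)

lemma invariant_cyc: "invariant (cyc v)"
proof (rule invariantI)
  show "0 \<in> cyc v" using act_0_left[of v] by (metis rangeI)
  show "u + w \<in> cyc v" if "u \<in> cyc v" "w \<in> cyc v" for u w
    using that by (auto simp: act_add_left[symmetric])
  show "g \<star> u \<in> cyc v" if "u \<in> cyc v" for g u
    using that by (auto simp: act_mult[symmetric])
qed

lemma generator_in_cyc: "v \<in> cyc v"
  using act_1[of v] by (metis rangeI)

lemma cyc_subset: "invariant W \<Longrightarrow> v \<in> W \<Longrightarrow> cyc v \<subseteq> W"
  using invariant_act by blast

lemma act_mod:
  assumes "q \<star> v = 0"
  shows "(h mod q) \<star> v = h \<star> v"
proof -
  have "h \<star> v = (h div q * q + h mod q) \<star> v" by simp
  also have "\<dots> = (h mod q) \<star> v" unfolding act_add_left act_mult assms by simp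
  finally show ?thesis by simp
qed

text \<open>An isomorphism is determined by the image \<open>v\<close> of the class of \<open>1\<close>: it commutes with
  multiplication by \<open>x\<close>, so it sends the class of \<open>h\<close> to \<open>h(T) v\<close>. From here on the concrete model
  of the quotient is replaced by a generator and its order.\<close>

lemma isomorphic_to_quotient_iff_cyclic:
  "isomorphic_to_quotient scale T W q \<longleftrightarrow> (\<exists>v. W = cyc v \<and> has_order v q)"
proof
  assume "isomorphic_to_quotient scale T W q"
  then obtain \<phi> where bij: "bij_betw \<phi> {g. g mod q = g} W"
    and add: "\<And>g h. g mod q = g \<Longrightarrow> h mod q = h \<Longrightarrow> \<phi> (g + h) = \<phi> g + \<phi> h"
    and smult: "\<And>c g. g mod q = g \<Longrightarrow> \<phi> (Polynomial.smult c g) = c *s \<phi> g"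
    and x: "\<And>g. g mod q = g \<Longrightarrow> \<phi> (([:0, 1:] * g) mod q) = T (\<phi> g)"
    unfolding isomorphic_to_quotient_def Let_def by auto
  define v where "v = \<phi> (1 mod q)"
  have zero: "\<phi> 0 = 0" using smult[of 0 0] by simp
  have eq: "\<phi> (h mod q) = h \<star> v" for h
  proof (induction h)
    case (pCons a h)
    have "pCons a h = Polynomial.smult a 1 + [:0, 1:] * h"
      by simp
    then have "pCons a h mod q = Polynomial.smult a 1 mod q + ([:0, 1:] * h) mod q"
      by (simp only: poly_mod_add_left)
    also have "\<dots> = Polynomial.smult a (1 mod q) + ([:0, 1:] * (h mod q)) mod q"
      by (simp only: mod_smult_left mod_mult_right_eq)
    finally have "\<phi> (pCons a h mod q) = a *s v + T (\<phi> (h mod q))"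
      using x[of "h mod q"] by (simp add: add smult v_def mod_smult_left)
    then show ?case using pCons.IH by (simp add: act_pCons)
  qed (simp add: zero)
  have "W = cyc v"
  proof -
    have "{g. g mod q = g} = range (\<lambda>h. h mod q)" by (auto, metis rangeI)
    then have "W = \<phi> ` range (\<lambda>h. h mod q)" using bij by (simp add: bij_betw_def)
    then show ?thesis by (simp add: image_image eq)
  qed
  moreover have "has_order v q"
    unfolding has_order_def
  proof
    fix g
    have "\<phi> (g mod q) = \<phi> 0 \<longleftrightarrow> g mod q = 0"
      using bij inj_on_eq_iff[of \<phi> "{g. g mod q = g}" "g mod q" 0] by (simp add: bij_betw_def)
    then show "g \<star> v = 0 \<longleftrightarrow> q dvd g" by (simp add: eq zero dvd_eq_mod_eq_0)
  qed
  ultimately show "\<exists>v. W = cyc v \<and> has_order v q" by blast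
next
  assume "\<exists>v. W = cyc v \<and> has_order v q"
  then obtain v where W: "W = cyc v" and ord: "has_order v q" by blast
  have "q \<star> v = 0" using has_orderD[OF ord] by simp
  note mod = act_mod[OF this]
  have "bij_betw (\<lambda>g. g \<star> v) {g. g mod q = g} W"
  proof (rule bij_betw_imageI)
    show "inj_on (\<lambda>g. g \<star> v) {g. g mod q = g}"
    proof (rule inj_onI)
      fix g h assume gh: "g \<in> {g. g mod q = g}" "h \<in> {g. g mod q = g}" "g \<star> v = h \<star> v"
      then have "q dvd g - h"
        using has_orderD[OF ord, of "g - h"] by (simp add: act_diff_left)
      then show "g = h" using gh by (simp add: mod_eq_dvd_iff[symmetric])
    qed
    show "(\<lambda>g. g \<star> v) ` {g. g mod q = g} = W"
    proof
      show "W \<subseteq> (\<lambda>g. g \<star> v) ` {g. g mod q = g}"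
      proof
        fix w assume "w \<in> W"
        then obtain h where "w = h \<star> v" using W by blast
        then show "w \<in> (\<lambda>g. g \<star> v) ` {g. g mod q = g}"
          using mod[of h] by (intro image_eqI[of _ _ "h mod q"]) auto
      qed
    qed (use W in auto)
  qed
  then show "isomorphic_to_quotient scale T W q"
    unfolding isomorphic_to_quotient_def Let_def
    by (intro exI[of _ "\<lambda>g. g \<star> v"]) (auto simp: act_add_left act_smult mod act_pCons)
qed

text \<open>If \<open>g = p\<^sup>a h\<close> with \<open>p\<close> not dividing \<open>h\<close> and \<open>a < k\<close>, then \<open>p\<^sup>k\<^sup>-\<^sup>1 v\<close> is killed by both \<open>p\<close> and
  \<open>h\<close>, hence by \<open>1\<close>.\<close>

lemma has_order_prime_power:
  assumes p: "irreducible p" and "p ^ k \<star> v = 0" "0 < k \<Longrightarrow> p ^ (k - 1) \<star> v \<noteq> 0"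
  shows "has_order v (p ^ k)"
  unfolding has_order_def
proof (intro allI iffI)
  fix g assume "p ^ k dvd g"
  then obtain c where "g = c * p ^ k" unfolding dvd_def by (metis mult.commute)
  then show "g \<star> v = 0" using assms(2) by (simp add: act_mult)
next
  fix g assume g: "g \<star> v = 0"
  show "p ^ k dvd g"
  proof (cases "g = 0")
    case False
    obtain a h where ah: "g = p ^ a * h" "\<not> p dvd h"
      by (rule prime_power_part[OF irreducible_poly_degree_pos[OF p] False])
    have "k \<le> a"
    proof (rule ccontr)
      assume "\<not> k \<le> a"
      then have k: "k - 1 = (k - 1 - a) + a" "k = Suc (k - 1)" by auto
      obtain s t where st: "s * p + t * h = 1"
        by (rule irreducible_poly_bezout[OF p ah(2)])
      have "p ^ (k - 1) = p ^ (k - 1 - a) * p ^ a" by (metis k(1) power_add)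
      moreover have "p ^ k = p ^ (k - 1) * p" by (metis k(2) power_Suc2)
      ultimately have split: "(s * p + t * h) * p ^ (k - 1) = s * p ^ k + t * p ^ (k - 1 - a) * (p ^ a * h)"
        by (simp only: distrib_right distrib_left mult_ac)
      have "p ^ (k - 1) \<star> v = ((s * p + t * h) * p ^ (k - 1)) \<star> v" by (simp add: st)
      also have "\<dots> = (s * p ^ k + t * p ^ (k - 1 - a) * (p ^ a * h)) \<star> v"
        by (simp only: split)
      also have "\<dots> = 0"
        using assms(2) g unfolding ah(1) by (simp add: act_add_left act_mult)
      finally show False using assms(3) k(2) by simp
    qed
    then show ?thesis using ah(1) le_imp_power_dvd dvd_mult2 by blast
  qed simp
qed

lemma prime_power_pred_act_nonzero:
  assumes "irreducible p" "has_order v (p ^ k)" "0 < k"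
  shows "p ^ (k - 1) \<star> v \<noteq> 0"
proof
  assume "p ^ (k - 1) \<star> v = 0"
  then have "p ^ k dvd p ^ (k - 1)" using has_orderD[OF assms(2)] by blast
  moreover have "p \<noteq> 0" "\<not> is_unit p" using assms(1) by (auto simp: irreducible_def)
  ultimately have "k \<le> k - 1" by (simp add: dvd_power_iff)
  then show False using assms(3) by simp
qed

text \<open>A cyclic space of prime power order has a unique minimal invariant subspace, generated by
  \<open>p\<^sup>k\<^sup>-\<^sup>1 v\<close>: multiplying any nonzero \<open>p\<^sup>a h v\<close> by \<open>p\<^sup>k\<^sup>-\<^sup>1\<^sup>-\<^sup>a\<close> and by an inverse of \<open>h\<close> modulo \<open>p\<close>
  yields that vector.\<close>

lemma socle_in_invariant_subspace:
  assumes p: "irreducible p" and ord: "has_order v (p ^ k)"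
    and N: "invariant N" "N \<subseteq> cyc v" "N \<noteq> {0}"
  shows "p ^ (k - 1) \<star> v \<in> N"
proof -
  have "0 \<in> N" using invariant_subspaceD[OF N(1)] by (rule subspace_0)
  then obtain y where y: "y \<in> N" "y \<noteq> 0" using N(3) by blast
  obtain g where g: "y = g \<star> v" using y N(2) by blast
  then have "g \<noteq> 0" using y by auto
  obtain a h where ah: "g = p ^ a * h" "\<not> p dvd h"
    by (rule prime_power_part[OF irreducible_poly_degree_pos[OF p] \<open>g \<noteq> 0\<close>])
  obtain s t where st: "s * p + t * h = 1"
    by (rule irreducible_poly_bezout[OF p ah(2)])
  have "\<not> k \<le> a"
  proof
    assume "k \<le> a"
    then have "p ^ k dvd g" using ah(1) le_imp_power_dvd dvd_mult2 by blast
    then show False using has_orderD[OF ord] g y(2) by simp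
  qed
  then obtain m where m: "k = Suc (a + m)" by (metis less_iff_Suc_add not_le)
  have "(t * p ^ m) \<star> y = (p ^ (a + m) * (t * h)) \<star> v"
    unfolding g ah(1) by (simp add: act_mult[symmetric] power_add algebra_simps)
  also have "t * h = 1 - s * p" using st by (simp add: algebra_simps)
  also have "(p ^ (a + m) * (1 - s * p)) \<star> v = p ^ (a + m) \<star> v - (s * p ^ k) \<star> v"
    unfolding m by (simp add: act_diff_left[symmetric] algebra_simps)
  also have "(s * p ^ k) \<star> v = 0" using has_orderD[OF ord] by simp
  finally have "p ^ (k - 1) \<star> v = (t * p ^ m) \<star> y" by (simp add: m)
  then show ?thesis using invariant_act[OF N(1) y(1)] by simp
qed

lemma indecomposable_cyc:
  assumes "irreducible p" "has_order v (p ^ k)" "0 < k"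
  shows "indecomposable scale T (cyc v)"
proof -
  note nz = prime_power_pred_act_nonzero[OF assms]
  have "cyc v \<noteq> {0}"
    using nz generator_in_cyc[of v] by auto
  moreover have "A = {0} \<or> B = {0}"
    if AB: "invariant A" "invariant B" "A \<inter> B = {0}" "{a + b | a b. a \<in> A \<and> b \<in> B} = cyc v" for A B
  proof (rule ccontr)
    assume "\<not> (A = {0} \<or> B = {0})"
    moreover have "A \<subseteq> cyc v" "B \<subseteq> cyc v"
      using AB subspace_0[OF invariant_subspaceD[OF AB(1)]] subspace_0[OF invariant_subspaceD[OF AB(2)]]
      by force+
    ultimately have "p ^ (k - 1) \<star> v \<in> A \<inter> B"
      using socle_in_invariant_subspace[OF assms(1,2)] AB(1,2) by blast
    then show False using AB(3) nz by simp
  qed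
  ultimately show ?thesis
    unfolding indecomposable_def using invariant_cyc by blast
qed

text \<open>The powers \<open>T\<^sup>i v\<close> with \<open>i\<close> below the degree of \<open>q\<close> form a basis: they span by division with
  remainder, and a dependence would be a nonzero polynomial of too small degree in the multiples of
  \<open>q\<close>.\<close>

lemma dim_cyc:
  assumes ord: "has_order v q" and "q \<noteq> 0"
  shows "dim (cyc v) = degree q"
proof -
  let ?b = "\<lambda>i. (T ^^ i) v"
  let ?B = "?b ` {..<degree q}"
  \<comment> \<open>A dependence between the \<open>T\<^sup>i v\<close> is a polynomial of degree below that of \<open>q\<close> which kills \<open>v\<close>.\<close>
  have free: "c i = 0" if "(\<Sum>i<degree q. c i *s ?b i) = 0" "i < degree q" for c i
  proof -
    define g where "g = (\<Sum>i<degree q. monom (c i) i)"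
    have coeff: "coeff g j = (if j < degree q then c j else 0)" for j
      by (simp add: g_def coeff_sum)
    have "g \<star> v = 0" using that(1) by (simp add: g_def act_sum_left act_monom)
    then have "q dvd g" using has_orderD[OF ord] by blast
    moreover have "degree g < degree q"
      using that(2) coeff by (intro degree_lessI) auto
    ultimately have "g = 0" by (metis dvd_imp_degree_le not_le)
    then show ?thesis using coeff[of i] that(2) by simp
  qed
  have inj: "inj_on ?b {..<degree q}"
  proof (rule inj_onI, rule ccontr)
    fix i j assume ij: "i \<in> {..<degree q}" "j \<in> {..<degree q}" "?b i = ?b j" "i \<noteq> j"
    define c :: "nat \<Rightarrow> 'a" where "c m = (if m = i then 1 else if m = j then - 1 else 0)" for m
    have "(\<Sum>m<degree q. c m *s ?b m) = (\<Sum>m\<in>{i, j}. c m *s ?b m)"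
      using ij by (intro sum.mono_neutral_right) (auto simp: c_def)
    also have "\<dots> = 0" using ij by (simp add: c_def scale_minus_left)
    finally have "c i = 0" using free ij(1) by blast
    then show False by (simp add: c_def)
  qed
  have "independent ?B"
    unfolding independent_explicit
  proof (intro conjI allI impI ballI)
    fix c w assume "(\<Sum>w\<in>?B. c w *s w) = 0" "w \<in> ?B"
    then show "c w = 0"
      using free[of "\<lambda>i. c (?b i)"] by (auto simp: sum.reindex[OF inj])
  qed simp
  moreover have "span ?B = span (cyc v)"
  proof
    have "?B \<subseteq> cyc v"
      using act_monom[of 1 _ v] by (auto simp: image_iff) (metis scale_one)
    then show "span ?B \<subseteq> span (cyc v)" by (rule span_mono)
    have "h \<star> v \<in> span ?B" for h
    proof -
      have "q \<star> v = 0" using has_orderD[OF ord] by simp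
      note act_mod[OF this, of h, symmetric]
      also have "(h mod q) \<star> v \<in> span ?B"
      proof (cases "h mod q = 0")
        case False
        then have "degree (h mod q) < degree q"
          using degree_mod_less[OF assms(2)] by blast
        then show ?thesis
          unfolding apply_poly_def by (intro span_sum span_scale span_base) auto
      qed (simp add: span_zero)
      finally show ?thesis .
    qed
    then have "cyc v \<subseteq> span ?B" by blast
    then show "span (cyc v) \<subseteq> span ?B" by (rule span_minimal) simp
  qed
  ultimately show ?thesis
    using dim_eq_card[of ?B "cyc v"] by (simp add: card_image[OF inj])
qed

lemma basis_list_exists: "\<exists>bs. is_basis_list scale bs"
proof -
  obtain bs where "set bs = Basis" "distinct bs"
    using finite_distinct_list[OF finite_Basis] by blast
  then show ?thesis
    unfolding is_basis_list_def using independent_Basis span_Basis by auto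
qed

lemma subspace_kernel: "subspace {v. g \<star> v = 0}"
  by (rule subspaceI) (auto simp: act_add_right act_scale)

text \<open>The determinant trick over \<open>F[x]\<close>: if \<open>C = x I - A\<close>, the columns of \<open>C\<close> are relations between
  the basis vectors, and multiplying by the adjugate of \<open>C\<close> shows that \<open>det C\<close> kills each of them.\<close>

lemma cayley_hamilton: "char_poly_of scale T \<star> v = 0"
  and monic_char_poly_of: "monic (char_poly_of scale T)"
proof -
  define bs where "bs = (SOME bs. is_basis_list scale bs)"
  have "is_basis_list scale bs"
    unfolding bs_def by (rule someI_ex[OF basis_list_exists])
  then have bs: "distinct bs" "independent (set bs)" "span (set bs) = UNIV"
    by (auto simp: is_basis_list_def)
  define n where "n = length bs"
  define A where "A = matrix_of scale bs T"
  define C where "C = char_poly_matrix A"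
  have A: "A \<in> carrier_mat n n" by (simp add: A_def matrix_of_def n_def)
  have \<chi>: "char_poly_of scale T = det C"
    by (simp add: char_poly_of_def bs_def[symmetric] A_def[symmetric] C_def char_poly_def)
  show "monic (char_poly_of scale T)"
    using degree_monic_char_poly[OF A]
    by (simp add: char_poly_of_def bs_def[symmetric] A_def[symmetric])
  have C: "C \<in> carrier_mat n n" using A by (simp add: C_def)
  have column: "T (bs ! j) = (\<Sum>i<n. A $$ (i, j) *s (bs ! i))" if j: "j < n" for j
  proof -
    have "T (bs ! j) = (\<Sum>b\<in>set bs. representation (set bs) (T (bs ! j)) b *s b)"
      using sum_representation_eq[OF bs(2), of "T (bs ! j)" "set bs"] bs(3) by simp
    also have "\<dots> = (\<Sum>i<n. representation (set bs) (T (bs ! j)) (bs ! i) *s (bs ! i))"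
      using bs(1) bij_betw_nth[OF bs(1), of "{..<n}" "set bs"]
      by (intro sum.reindex_bij_betw[symmetric]) (simp add: n_def lessThan_atLeast0 bij_betw_nth)
    finally show ?thesis
      using j by (simp add: A_def matrix_of_def n_def)
  qed
  have entry: "C $$ (i, j) = (if i = j then [:0, 1:] else 0) - [:A $$ (i, j):]"
    if "i < n" "j < n" for i j
    using that A by (auto simp: C_def char_poly_matrix_def)
  have relation: "(\<Sum>i<n. C $$ (i, j) \<star> (bs ! i)) = 0" if j: "j < n" for j
  proof -
    have "(\<Sum>i<n. C $$ (i, j) \<star> (bs ! i))
        = (\<Sum>i<n. (if i = j then T (bs ! i) else 0) - A $$ (i, j) *s (bs ! i))"
      using j by (intro sum.cong) (auto simp: entry act_diff_left act_x act_pCons T_zero)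
    also have "\<dots> = 0" using j column[OF j] by (simp add: sum_subtractf)
    finally show ?thesis .
  qed
  have "det C \<star> (bs ! k) = 0" if k: "k < n" for k
  proof -
    let ?D = "adj_mat C"
    have D: "?D \<in> carrier_mat n n" by (rule adj_mat(1)[OF C])
    have "(\<Sum>j<n. C $$ (i, j) * ?D $$ (j, k)) = (if i = k then det C else 0)" if i: "i < n" for i
    proof -
      have "(C * ?D) $$ (i, k) = (\<Sum>j<n. C $$ (i, j) * ?D $$ (j, k))"
        using C D i k by (auto simp: times_mat_def scalar_prod_def lessThan_atLeast0 intro!: sum.cong)
      moreover have "(C * ?D) $$ (i, k) = (if i = k then det C else 0)"
        unfolding adj_mat(2)[OF C] using i k by simp
      ultimately show ?thesis by simp
    qed
    then have "det C \<star> (bs ! k) = (\<Sum>i<n. (\<Sum>j<n. C $$ (i, j) * ?D $$ (j, k)) \<star> (bs ! i))"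
      using k by (simp add: if_distrib[of "\<lambda>g. apply_poly scale g T _"] sum.delta cong: if_cong)
    also have "\<dots> = (\<Sum>i<n. \<Sum>j<n. ?D $$ (j, k) \<star> C $$ (i, j) \<star> (bs ! i))"
      by (simp add: act_sum_left act_mult[symmetric] mult.commute)
    also have "\<dots> = (\<Sum>j<n. ?D $$ (j, k) \<star> (\<Sum>i<n. C $$ (i, j) \<star> (bs ! i)))"
      by (subst sum.swap) (simp add: act_sum_right)
    also have "\<dots> = 0" using relation by simp
    finally show ?thesis .
  qed
  then have "set bs \<subseteq> {v. det C \<star> v = 0}"
    by (auto simp: in_set_conv_nth n_def)
  then have "span (set bs) \<subseteq> {v. det C \<star> v = 0}"
    by (rule span_minimal) (rule subspace_kernel)
  then show "char_poly_of scale T \<star> v = 0"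
    using bs(3) \<chi> by auto
qed

end

section \<open>Existence of the primary cyclic decomposition\<close>

abbreviation set_sum :: "'b::plus set \<Rightarrow> 'b set \<Rightarrow> 'b set" (infixl \<open>\<boxplus>\<close> 65)
  where "U \<boxplus> W \<equiv> {u + w | u w. u \<in> U \<and> w \<in> W}"

context linear_endo begin

definition functional :: "('b \<Rightarrow> 'a) \<Rightarrow> bool"
  where "functional l \<longleftrightarrow> (\<forall>u v. l (u + v) = l u + l v) \<and> (\<forall>c v. l (c *s v) = c * l v)"

lemma functional_add: "functional l \<Longrightarrow> l (u + v) = l u + l v"
  and functional_scale: "functional l \<Longrightarrow> l (c *s v) = c * l v"
  by (auto simp: functional_def)

lemma functional_zero: "functional l \<Longrightarrow> l 0 = 0"
  using functional_scale[of l 0 0] by simp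

lemma functional_diff: "functional l \<Longrightarrow> l (u - v) = l u - l v"
  by (metis add_diff_cancel_right' diff_add_cancel functional_add)

lemma functional_sum: "functional l \<Longrightarrow> l (sum f A) = (\<Sum>a\<in>A. l (f a))"
  by (induction A rule: infinite_finite_induct) (auto simp: functional_zero functional_add)

lemma functional_act: "functional l \<Longrightarrow> functional (\<lambda>v. l (g \<star> v))"
  by (simp add: functional_def act_add_right act_scale)

lemma functional_exists:
  assumes "z \<noteq> 0"
  obtains l where "functional l" "l z \<noteq> 0"
proof -
  define E where "E = extend_basis {z}"
  have ind: "independent {z}" using assms by (simp add: dependent_single)
  have E: "independent E" "span E = UNIV" "z \<in> E"
    using independent_extend_basis[OF ind] span_extend_basis[OF ind] extend_basis_superset[OF ind]
    by (auto simp: E_def)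
  let ?l = "\<lambda>v. representation E v z"
  have "functional ?l"
    unfolding functional_def using E by (auto simp: representation_add representation_scale)
  moreover have "?l z \<noteq> 0"
    using E by (simp add: representation_basis)
  ultimately show thesis using that[of ?l] by blast
qed

lemma dim_le_dim_hyperplane:
  assumes W: "subspace W" and l: "functional l"
  shows "dim W \<le> dim {w \<in> W. l w = 0} + 1"
proof (cases "\<exists>u\<in>W. l u \<noteq> 0")
  case True
  then obtain u where u: "u \<in> W" "l u \<noteq> 0" by blast
  let ?K = "{w \<in> W. l w = 0}"
  have "w \<in> span (insert u ?K)" if "w \<in> W" for w
  proof -
    let ?c = "l w / l u"
    have "w - ?c *s u \<in> ?K"
      using that u by (simp add: functional_diff[OF l] functional_scale[OF l] subspace_diff[OF W] subspace_scale[OF W])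
    then have "(w - ?c *s u) + ?c *s u \<in> span (insert u ?K)"
      by (intro span_add span_scale span_base) auto
    then show ?thesis by simp
  qed
  then have "dim W \<le> dim (insert u ?K)" by (intro dim_mono) blast
  then show ?thesis by (simp add: dim_insert split: if_splits)
next
  case False
  then have "{w \<in> W. l w = 0} = W" by blast
  then show ?thesis by simp
qed

text \<open>Each functional lowers the dimension by at most one. Both the complement of a cyclic summand and
  the orthogonal complement of an image are estimated this way.\<close>

lemma dim_le_dim_annihilated:
  assumes "finite F" "subspace W" "\<And>l. l \<in> F \<Longrightarrow> functional l"
  shows "dim W \<le> dim {w \<in> W. \<forall>l\<in>F. l w = 0} + card F"
  using assms
proof (induction F arbitrary: W rule: finite_induct)
  case (insert l F)
  have l: "functional l" using insert.prems by simp
  let ?K = "{w \<in> W. l w = 0}"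
  have "subspace ?K"
    using insert.prems(1) by (auto simp: subspace_def functional_add[OF l] functional_scale[OF l] functional_zero[OF l])
  then have "dim ?K \<le> dim {w \<in> ?K. \<forall>l\<in>F. l w = 0} + card F"
    using insert by blast
  moreover have "{w \<in> ?K. \<forall>l\<in>F. l w = 0} = {w \<in> W. \<forall>l'\<in>insert l F. l' w = 0}" by auto
  ultimately show ?case
    using dim_le_dim_hyperplane[OF insert.prems(1) l] insert.hyps by simp
qed simp

lemma invariant_0: "invariant {0}"
  by (rule invariantI) auto

lemma zero_in_invariant: "invariant W \<Longrightarrow> 0 \<in> W"
  by (rule subspace_0[OF invariant_subspaceD])

lemma invariant_sum:
  assumes "invariant U" "invariant W"
  shows "invariant (U \<boxplus> W)"
proof (rule invariantI)
  show "0 \<in> U \<boxplus> W" using zero_in_invariant[OF assms(1)] zero_in_invariant[OF assms(2)] by force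
next
  fix x y assume "x \<in> U \<boxplus> W" "y \<in> U \<boxplus> W"
  then obtain u w u' w' where *: "x = u + w" "y = u' + w'" "u \<in> U" "w \<in> W" "u' \<in> U" "w' \<in> W" by blast
  then have "x + y = (u + u') + (w + w')" by simp
  moreover have "u + u' \<in> U" "w + w' \<in> W"
    using * subspace_add[OF invariant_subspaceD] assms by blast+
  ultimately show "x + y \<in> U \<boxplus> W" by blast
next
  fix g x assume "x \<in> U \<boxplus> W"
  then show "g \<star> x \<in> U \<boxplus> W"
    using assms invariant_act by (fastforce simp: act_add_right)
qed

lemma set_sum_superset:
  assumes "invariant U" "invariant W"
  shows "U \<subseteq> U \<boxplus> W" "W \<subseteq> U \<boxplus> W"
  using zero_in_invariant[OF assms(1)] zero_in_invariant[OF assms(2)] by force+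

lemma set_sum_unique:
  assumes "invariant U" "invariant W" "U \<inter> W = {0}"
    and "u \<in> U" "u' \<in> U" "w \<in> W" "w' \<in> W" "u + w = u' + w'"
  shows "u = u'" "w = w'"
proof -
  have "u - u' = w' - w" using assms(8) by (simp add: algebra_simps)
  moreover have "u - u' \<in> U" "w' - w \<in> W"
    using assms subspace_diff[OF invariant_subspaceD] by blast+
  ultimately have "u - u' \<in> U \<inter> W" by simp
  then show "u = u'" using assms(3) by simp
  then show "w = w'" using assms(8) by simp
qed

lemma dim_direct_sum:
  assumes "subspace U" "subspace W" "U \<inter> W = {0}"
  shows "dim (U \<boxplus> W) = dim U + dim W"
  using dim_sums_Int[OF assms(1,2)] assms(3) by simp

text \<open>The building block of the decomposition: a copy of \<open>F[x]/(p\<^sup>k)\<close> with its elementary divisor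
  \<open>q = p\<^sup>k\<close>.\<close>

definition primary_cyclic :: "'b set \<Rightarrow> 'a poly \<Rightarrow> bool" where
  "primary_cyclic U q \<longleftrightarrow>
     (\<exists>v p k. U = cyc v \<and> has_order v q \<and> q = p ^ k \<and> irreducible p \<and> monic p \<and> 0 < k)"

lemma primary_cyclic_invariant: "primary_cyclic U q \<Longrightarrow> invariant U"
  unfolding primary_cyclic_def using invariant_cyc by blast

text \<open>Decompositions as a finite chain of direct sums rather than an indexed family, so that rule
  induction adds one summand at a time and summands can be removed without renumbering.\<close>

inductive primary_decomp :: "'b set \<Rightarrow> 'a poly multiset \<Rightarrow> bool" where
  primary_decomp_zero: "primary_decomp {0} {#}"
| primary_decomp_add: "primary_decomp W M \<Longrightarrow> primary_cyclic U q \<Longrightarrow> U \<inter> W = {0} \<Longrightarrow> primary_decomp (U \<boxplus> W) (add_mset q M)"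

lemma primary_decomp_invariant: "primary_decomp W M \<Longrightarrow> invariant W"
  by (induction rule: primary_decomp.induct) (simp_all add: invariant_0 primary_cyclic_invariant invariant_sum)

text \<open>Let \<open>m = p\<^sup>a m'\<close> be the minimal polynomial on \<open>W\<close>, with \<open>p\<close> prime to \<open>m'\<close>, and let \<open>v\<close> in \<open>m' W\<close> have
  order \<open>p\<^sup>a\<close>. Choose a functional \<open>l\<close> that is nonzero at \<open>m' p\<^sup>a\<^sup>-\<^sup>1 v\<close>. The complement is the
  largest invariant subspace \<open>N\<close> on which \<open>l \<circ> m'(T)\<close> vanishes. It misses the minimal
  invariant subspace of the orbit of \<open>v\<close>, so it meets that orbit trivially. It has codimension at
  most the degree of \<open>p\<^sup>a\<close>, because \<open>p\<^sup>a m'\<close> kills \<open>W\<close> and only the conditions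
  \<open>l (T\<^sup>i m' w) = 0\<close> with \<open>i\<close> below that degree count; so the two together fill \<open>W\<close>.\<close>

lemma primary_cyclic_complement:
  assumes W: "invariant W" "W \<noteq> {0}"
  obtains C q N where "primary_cyclic C q" "invariant N" "C \<inter> N = {0}" "W = C \<boxplus> N"
proof -
  define I where "I = {g. \<forall>w\<in>W. g \<star> w = 0}"
  have \<chi>: "char_poly_of scale T \<in> I" "char_poly_of scale T \<noteq> 0"
    using cayley_hamilton monic_char_poly_of by (auto simp: I_def)
  obtain m where m: "m \<in> I" "m \<noteq> 0" "\<forall>g\<in>I. m dvd g"
    by (rule poly_ideal_generator[OF \<chi>]) (auto simp: I_def act_add_left act_mult)
  have "0 < degree m"
  proof (rule ccontr)
    assume "\<not> 0 < degree m"
    then obtain c where c: "m = [:c:]" by (auto elim: degree_eq_zeroE)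
    have "w = 0" if "w \<in> W" for w
      using m(1,2) that by (auto simp: I_def c act_pCons T_zero)
    then show False using W zero_in_invariant[OF W(1)] by blast
  qed
  then obtain p r where p: "irreducible p" "m = p * r" "monic p"
    using irreducible_monic_factor by blast
  obtain a m' where m': "m = p ^ a * m'" "\<not> p dvd m'"
    by (rule prime_power_part[OF irreducible_poly_degree_pos[OF p(1)] m(2)])
  have "a \<noteq> 0" using m' p(2) by (metis dvd_triv_left mult_1 power_0)
  then have Suc_a: "a = Suc (a - 1)" by simp
  have pa: "p ^ a = p ^ (a - 1) * p" by (metis Suc_a power_Suc2)
  \<comment> \<open>Minimality of \<open>m\<close>: dropping one factor \<open>p\<close> leaves a polynomial that no longer annihilates \<open>W\<close>.\<close>
  have "p ^ (a - 1) * m' \<notin> I"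
  proof
    assume "p ^ (a - 1) * m' \<in> I"
    then have "m dvd p ^ (a - 1) * m'" using m(3) by blast
    moreover have "m = p ^ (a - 1) * m' * p" by (simp only: m'(1) pa mult_ac)
    ultimately have "p ^ (a - 1) * m' * p dvd p ^ (a - 1) * m' * 1" by simp
    moreover have "p ^ (a - 1) * m' \<noteq> 0" using m(2) m'(1) by auto
    ultimately have "is_unit p" using dvd_mult_cancel_left by blast
    then show False using p(1) by (simp add: irreducible_def)
  qed
  then obtain w0 where w0: "w0 \<in> W" "(p ^ (a - 1) * m') \<star> w0 \<noteq> 0"
    by (auto simp: I_def)
  define v where "v = m' \<star> w0"
  have v: "v \<in> W" using w0(1) invariant_act[OF W(1)] by (simp add: v_def)
  have pa_m': "p ^ a \<star> m' \<star> w = 0" if "w \<in> W" for w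
    using m(1) that by (auto simp: I_def m'(1) act_mult)
  define z where "z = m' \<star> p ^ (a - 1) \<star> v"
  have "z \<noteq> 0"
  proof
    assume "z = 0"
    obtain s t where st: "s * p + t * m' = 1" by (rule irreducible_poly_bezout[OF p(1) m'(2)])
    have "(p ^ (a - 1) * m') \<star> w0 = (s * p + t * m') \<star> p ^ (a - 1) \<star> v"
      by (simp add: st v_def act_mult)
    also have "\<dots> = s \<star> p ^ a \<star> v + t \<star> z"
      by (simp add: act_add_left act_mult z_def pa act_commute[of p])
    also have "\<dots> = 0" using \<open>z = 0\<close> pa_m'[OF w0(1)] by (simp add: v_def)
    finally show False using w0(2) by simp
  qed
  then obtain l where l: "functional l" "l z \<noteq> 0" by (rule functional_exists)
  have ord: "has_order v (p ^ a)"
  proof (rule has_order_prime_power[OF p(1)])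
    show "p ^ a \<star> v = 0" using pa_m'[OF w0(1)] by (simp add: v_def)
    show "p ^ (a - 1) \<star> v \<noteq> 0" using \<open>z \<noteq> 0\<close> by (auto simp: z_def)
  qed
  define N where "N = {w \<in> W. \<forall>g. l (g \<star> m' \<star> w) = 0}"
  have N: "invariant N"
  proof (rule invariantI)
    show "0 \<in> N" using zero_in_invariant[OF W(1)] by (simp add: N_def functional_zero[OF l(1)])
    show "u + w \<in> N" if "u \<in> N" "w \<in> N" for u w
      using that subspace_add[OF invariant_subspaceD[OF W(1)]]
      by (simp add: N_def act_add_right functional_add[OF l(1)])
    show "g \<star> w \<in> N" if "w \<in> N" for g w
    proof -
      have "l (h \<star> m' \<star> g \<star> w) = 0" for h
      proof -
        have "h \<star> m' \<star> g \<star> w = (h * g) \<star> m' \<star> w" by (simp add: act_mult act_commute[of g])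
        then show ?thesis using that by (simp add: N_def)
      qed
      then show ?thesis using that invariant_act[OF W(1)] by (simp add: N_def)
    qed
  qed
  have int: "cyc v \<inter> N = {0}"
  proof (rule ccontr)
    assume ne: "cyc v \<inter> N \<noteq> {0}"
    have "invariant (cyc v \<inter> N)"
    proof (rule invariantI)
      show "0 \<in> cyc v \<inter> N" using zero_in_invariant N invariant_cyc by blast
      show "u + w \<in> cyc v \<inter> N" if "u \<in> cyc v \<inter> N" "w \<in> cyc v \<inter> N" for u w
        using that subspace_add[OF invariant_subspaceD] N invariant_cyc by blast
      show "g \<star> w \<in> cyc v \<inter> N" if "w \<in> cyc v \<inter> N" for g w
        using that invariant_act N invariant_cyc by blast
    qed
    from socle_in_invariant_subspace[OF p(1) ord this _ ne]
    have "p ^ (a - 1) \<star> v \<in> N" by blast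
    then have "l (1 \<star> m' \<star> p ^ (a - 1) \<star> v) = 0" unfolding N_def by blast
    then show False using l(2) by (simp add: z_def)
  qed
  have pa_ne: "p ^ a \<noteq> 0" using p(1) by auto
  let ?d = "degree (p ^ a)"
  let ?F = "(\<lambda>i w. l (monom 1 i \<star> m' \<star> w)) ` {..<?d}"
  have "dim W \<le> dim {w \<in> W. \<forall>f\<in>?F. f w = 0} + card ?F"
    by (rule dim_le_dim_annihilated)
      (use functional_act[OF functional_act[OF l(1)]] invariant_subspaceD[OF W(1)] in auto)
  moreover have "card ?F \<le> ?d" using card_image_le[of "{..<?d}"] by simp
  moreover have "{w \<in> W. \<forall>f\<in>?F. f w = 0} = N"
  proof
    show "N \<subseteq> {w \<in> W. \<forall>f\<in>?F. f w = 0}" by (auto simp: N_def)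
    show "{w \<in> W. \<forall>f\<in>?F. f w = 0} \<subseteq> N"
    proof
      fix w assume w: "w \<in> {w \<in> W. \<forall>f\<in>?F. f w = 0}"
      then have zero: "l ((T ^^ i) (m' \<star> w)) = 0" if "i < ?d" for i
        using that by (auto simp: act_monom)
      have "l (g \<star> m' \<star> w) = 0" for g
      proof -
        have "g \<star> m' \<star> w = (g mod p ^ a) \<star> m' \<star> w"
          using act_mod[OF pa_m'] w by simp
        moreover have "l ((g mod p ^ a) \<star> m' \<star> w) = 0"
        proof (cases "g mod p ^ a = 0")
          case False
          then have "degree (g mod p ^ a) < ?d" using degree_mod_less[OF pa_ne] by blast
          then show ?thesis
            unfolding apply_poly_def[of _ "g mod p ^ a"]
            by (simp add: functional_sum[OF l(1)] functional_scale[OF l(1)] zero)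
        qed (simp add: functional_zero[OF l(1)])
        ultimately show ?thesis by simp
      qed
      then show "w \<in> N" using w by (simp add: N_def)
    qed
  qed
  ultimately have "dim W \<le> dim (cyc v) + dim N"
    using dim_cyc[OF ord pa_ne] by simp
  also have "\<dots> = dim (cyc v \<boxplus> N)"
    using dim_direct_sum[OF invariant_subspaceD[OF invariant_cyc] invariant_subspaceD[OF N] int] by simp
  finally have "dim W \<le> dim (cyc v \<boxplus> N)" .
  moreover have "cyc v \<boxplus> N \<subseteq> W"
  proof
    fix x assume "x \<in> cyc v \<boxplus> N"
    then obtain c n where cn: "x = c + n" "c \<in> cyc v" "n \<in> N" by blast
    have "c \<in> W" using cyc_subset[OF W(1) v] cn(2) by blast
    moreover have "n \<in> W" using cn(3) by (simp add: N_def)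
    ultimately show "x \<in> W"
      unfolding cn(1) by (rule subspace_add[OF invariant_subspaceD[OF W(1)]])
  qed
  ultimately have "cyc v \<boxplus> N = W"
    by (intro subspace_dim_equal[OF invariant_subspaceD[OF invariant_sum[OF invariant_cyc N]] invariant_subspaceD[OF W(1)]])
  moreover have "primary_cyclic (cyc v) (p ^ a)"
    unfolding primary_cyclic_def using ord p \<open>a \<noteq> 0\<close> by blast
  ultimately show thesis by (intro that[of "cyc v" "p ^ a" N]) (simp_all add: N int)
qed

lemma primary_cyclic_nonzero:
  assumes "primary_cyclic U q"
  shows "U \<noteq> {0}"
proof -
  obtain v p k where U: "U = cyc v" "has_order v (p ^ k)" "irreducible p" "0 < k"
    using assms unfolding primary_cyclic_def by blast
  show ?thesis
    using prime_power_pred_act_nonzero[OF U(3,2,4)] U(1) by blast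
qed

theorem primary_decomp_exists: "invariant W \<Longrightarrow> \<exists>M. primary_decomp W M"
proof (induction "dim W" arbitrary: W rule: less_induct)
  case less
  show ?case
  proof (cases "W = {0}")
    case True
    then show ?thesis using primary_decomp_zero by blast
  next
    case False
    obtain C q N where C: "primary_cyclic C q" "invariant N" "C \<inter> N = {0}" "W = C \<boxplus> N"
      by (rule primary_cyclic_complement[OF less.prems False])
    have "dim W = dim C + dim N"
      unfolding C(4) using C primary_cyclic_invariant invariant_subspaceD by (intro dim_direct_sum) auto
    moreover have "dim C \<noteq> 0"
      using primary_cyclic_nonzero[OF C(1)] zero_in_invariant[OF primary_cyclic_invariant[OF C(1)]]
      by (metis dim_eq_0 empty_iff subset_singleton_iff)
    ultimately have "dim N < dim W" by linarith
    then obtain M where "primary_decomp N M" using less.hyps[of N] C(2) by blast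
    then show ?thesis using primary_decomp_add[OF _ C(1,3)] C(4) by blast
  qed
qed

end

section \<open>Multiplicities of elementary divisors\<close>

context linear_endo begin

lemma set_sumI: "u \<in> U \<Longrightarrow> w \<in> W \<Longrightarrow> u + w \<in> U \<boxplus> W"
  by blast

lemma set_sum_assoc:
  fixes U V W :: "'b set"
  shows "U \<boxplus> (V \<boxplus> W) = (U \<boxplus> V) \<boxplus> W"
proof
  show "U \<boxplus> (V \<boxplus> W) \<subseteq> (U \<boxplus> V) \<boxplus> W"
  proof
    fix x assume "x \<in> U \<boxplus> (V \<boxplus> W)"
    then obtain u v w where *: "x = u + (v + w)" "u \<in> U" "v \<in> V" "w \<in> W" by blast
    show "x \<in> (U \<boxplus> V) \<boxplus> W"
      unfolding *(1) add.assoc[symmetric] by (intro set_sumI *(2-4))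
  qed
  show "(U \<boxplus> V) \<boxplus> W \<subseteq> U \<boxplus> (V \<boxplus> W)"
  proof
    fix x assume "x \<in> (U \<boxplus> V) \<boxplus> W"
    then obtain u v w where *: "x = (u + v) + w" "u \<in> U" "v \<in> V" "w \<in> W" by blast
    show "x \<in> U \<boxplus> (V \<boxplus> W)"
      unfolding *(1) add.assoc by (intro set_sumI *(2-4))
  qed
qed

lemma set_sum_commute:
  fixes U W :: "'b set"
  shows "U \<boxplus> W = W \<boxplus> U"
  using add.commute by blast

lemma set_sum_0:
  fixes W :: "'b set"
  shows "{0} \<boxplus> W = W"
  by auto

lemma direct_sum_assoc_disjoint:
  assumes "invariant U" "invariant V" "invariant W"
    and "V \<inter> W = {0}" "U \<inter> (V \<boxplus> W) = {0}"
  shows "U \<inter> V = {0}" "(U \<boxplus> V) \<inter> W = {0}"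
proof -
  show "U \<inter> V = {0}"
    using set_sum_superset(1)[OF assms(2,3)] assms(5) zero_in_invariant assms(1,2) by blast
  have "x = 0" if x: "x \<in> U \<boxplus> V" "x \<in> W" for x
  proof -
    obtain u v where uv: "x = u + v" "u \<in> U" "v \<in> V" using x(1) by blast
    then have "u = (- v) + x" by simp
    moreover have "- v \<in> V" using uv(3) subspace_neg[OF invariant_subspaceD[OF assms(2)]] by blast
    ultimately have "u \<in> U \<inter> (V \<boxplus> W)" using uv(2) x(2) by blast
    then have "u = 0" using assms(5) by simp
    then have "x \<in> V \<inter> W" using uv x by simp
    then show "x = 0" using assms(4) by simp
  qed
  then show "(U \<boxplus> V) \<inter> W = {0}"
    using zero_in_invariant[OF invariant_sum[OF assms(1,2)]] zero_in_invariant[OF assms(3)] by blast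
qed

lemma primary_decomp_sum:
  assumes "primary_decomp U M" "primary_decomp W N" "U \<inter> W = {0}"
  shows "primary_decomp (U \<boxplus> W) (M + N)"
  using assms(1,3)
proof (induction rule: primary_decomp.induct)
  case primary_decomp_zero
  then show ?case using assms(2) by (simp add: set_sum_0)
next
  case (primary_decomp_add V M C q)
  note inv = primary_cyclic_invariant[OF primary_decomp_add.hyps(2)] primary_decomp_invariant[OF primary_decomp_add.hyps(1)]
    primary_decomp_invariant[OF assms(2)]
  have "W \<inter> (V \<boxplus> C) = {0}" using primary_decomp_add.prems by (metis Int_commute set_sum_commute)
  moreover have "V \<inter> C = {0}" using primary_decomp_add.hyps(3) by blast
  ultimately have d: "W \<inter> V = {0}" "(W \<boxplus> V) \<inter> C = {0}"
    using direct_sum_assoc_disjoint[OF inv(3,2,1)] by blast+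
  have "primary_decomp (V \<boxplus> W) (M + N)" using primary_decomp_add.IH d(1) by blast
  moreover have "C \<inter> (V \<boxplus> W) = {0}" using d(2) by (metis Int_commute set_sum_commute)
  ultimately have "primary_decomp (C \<boxplus> (V \<boxplus> W)) (add_mset q (M + N))"
    by (rule primary_decomp.primary_decomp_add[OF _ primary_decomp_add.hyps(2)])
  then show ?case unfolding set_sum_assoc by simp
qed

text \<open>Any summand can be brought to the front, which is what allows an induction to pick a summand
  together with its dual.\<close>

lemma primary_decomp_remove:
  assumes "primary_decomp W M" "q \<in># M"
  obtains U V where "primary_cyclic U q" "primary_decomp V (M - {#q#})" "U \<inter> V = {0}" "W = U \<boxplus> V"
proof -
  have "\<exists>U V. primary_cyclic U q \<and> primary_decomp V (M - {#q#}) \<and> U \<inter> V = {0} \<and> W = U \<boxplus> V"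
    using assms
  proof (induction rule: primary_decomp.induct)
    case (primary_decomp_add W M C r)
    show ?case
    proof (cases "q = r")
      case True
      then show ?thesis using primary_decomp_add.hyps by (intro exI[of _ C] exI[of _ W]) simp
    next
      case False
      then have "q \<in># M" using primary_decomp_add.prems by simp
      then obtain U V where UV: "primary_cyclic U q" "primary_decomp V (M - {#q#})" "U \<inter> V = {0}" "W = U \<boxplus> V"
        using primary_decomp_add.IH by blast
      note inv = primary_cyclic_invariant[OF primary_decomp_add.hyps(2)] primary_decomp_invariant[OF UV(2)] primary_cyclic_invariant[OF UV(1)]
      have "C \<inter> (V \<boxplus> U) = {0}" using primary_decomp_add.hyps(3) UV(4) by (metis set_sum_commute)
      moreover have "V \<inter> U = {0}" using UV(3) by blast
      ultimately have d: "C \<inter> V = {0}" "(C \<boxplus> V) \<inter> U = {0}"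
        using direct_sum_assoc_disjoint[OF inv] by blast+
      have "primary_decomp (C \<boxplus> V) (add_mset r (M - {#q#}))"
        by (rule primary_decomp.primary_decomp_add[OF UV(2) primary_decomp_add.hyps(2) d(1)])
      moreover have "add_mset r (M - {#q#}) = add_mset r M - {#q#}" using False by simp
      moreover have "U \<inter> (C \<boxplus> V) = {0}" using d(2) by blast
      moreover have "C \<boxplus> W = U \<boxplus> (C \<boxplus> V)"
        by (subst UV(4), subst (1 2) set_sum_assoc, subst set_sum_commute[of C U], rule refl)
      ultimately show ?thesis using UV(1) by (intro exI[of _ U] exI[of _ "C \<boxplus> V"]) simp
    qed
  qed simp
  then show thesis using that by blast
qed

lemma primary_decomp_element:
  assumes "primary_decomp W M" "q \<in># M"
  obtains v p k where "v \<in> W" "has_order v q" "q = p ^ k" "irreducible p" "monic p" "0 < k"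
proof -
  obtain U V where UV: "primary_cyclic U q" "primary_decomp V (M - {#q#})" "U \<inter> V = {0}" "W = U \<boxplus> V"
    by (rule primary_decomp_remove[OF assms])
  then obtain v p k where v: "U = cyc v" "has_order v q" "q = p ^ k" "irreducible p" "monic p" "0 < k"
    unfolding primary_cyclic_def by blast
  have "v \<in> W"
    using set_sum_superset(1)[OF primary_cyclic_invariant[OF UV(1)] primary_decomp_invariant[OF UV(2)]]
      generator_in_cyc[of v] UV(4) v(1) by blast
  then show thesis using that v by blast
qed

text \<open>The bridge between indexed direct sums and the binary ones used in \<open>primary_decomp\<close>.\<close>

lemma direct_sum_Suc:
  assumes U: "\<And>i. i \<le> m \<Longrightarrow> invariant (U i)"
  shows "direct_sum (Suc m) U W \<longleftrightarrow> (\<exists>V. direct_sum m U V \<and> W = U m \<boxplus> V \<and> U m \<inter> V = {0})"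
proof
  assume *: "direct_sum (Suc m) U W"
  then have W: "W = {\<Sum>i<Suc m. w i | w. \<forall>i<Suc m. w i \<in> U i}"
    and indep: "\<And>w i. (\<forall>i<Suc m. w i \<in> U i) \<Longrightarrow> (\<Sum>i<Suc m. w i) = 0 \<Longrightarrow> i < Suc m \<Longrightarrow> w i = 0"
    unfolding direct_sum_def by blast+
  define V where "V = {\<Sum>i<m. w i | w. \<forall>i<m. w i \<in> U i}"
  have upd: "(\<Sum>i<Suc m. (w(m := x)) i) = x + (\<Sum>i<m. w i)"
    "(\<forall>i<m. w i \<in> U i) \<Longrightarrow> x \<in> U m \<Longrightarrow> \<forall>i<Suc m. (w(m := x)) i \<in> U i" for w x
    by (auto simp: less_Suc_eq intro!: sum.cong)
  have zero: "0 \<in> U i" if "i \<le> m" for i using U[OF that] by (rule zero_in_invariant)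
  have "direct_sum m U V"
    unfolding direct_sum_def
  proof (intro conjI allI impI)
    show "V = {\<Sum>i<m. w i | w. \<forall>i<m. w i \<in> U i}" by (fact V_def)
    fix w i assume w: "(\<forall>i<m. w i \<in> U i) \<and> (\<Sum>i<m. w i) = 0" "i < m"
    then show "w i = 0"
      using indep[OF upd(2)[of w 0], of i] upd(1)[of w 0] zero[of m] by auto
  qed
  moreover have "W = U m \<boxplus> V"
  proof
    show "W \<subseteq> U m \<boxplus> V"
    proof
      fix x assume "x \<in> W"
      then obtain w where w: "x = w m + (\<Sum>i<m. w i)" "\<forall>i<Suc m. w i \<in> U i"
        unfolding W by (auto simp: add.commute)
      moreover have "(\<Sum>i<m. w i) \<in> V" using w(2) unfolding V_def by fastforce
      ultimately show "x \<in> U m \<boxplus> V" by blast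
    qed
    show "U m \<boxplus> V \<subseteq> W"
    proof
      fix x assume "x \<in> U m \<boxplus> V"
      then obtain u w where "u \<in> U m" "x = u + (\<Sum>i<m. w i)" "\<forall>i<m. w i \<in> U i"
        unfolding V_def by blast
      then show "x \<in> W" using upd[of w u] unfolding W mem_Collect_eq by metis
    qed
  qed
  moreover have "x = 0" if x: "x \<in> U m" "x \<in> V" for x
  proof -
    obtain w where w: "x = (\<Sum>i<m. w i)" "\<forall>i<m. w i \<in> U i"
      using x(2) unfolding V_def by blast
    have "- x \<in> U m" using x(1) subspace_neg[OF invariant_subspaceD[OF U]] by blast
    then have "(w(m := - x)) m = 0"
      by (intro indep[OF upd(2)[OF w(2)]]) (simp_all only: upd(1) w(1)[symmetric], simp_all)
    then show "x = 0" by simp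
  qed
  moreover have "0 \<in> V" using zero by (auto simp: V_def intro!: exI[of _ "\<lambda>_. 0"])
  ultimately show "\<exists>V. direct_sum m U V \<and> W = U m \<boxplus> V \<and> U m \<inter> V = {0}"
    using zero[of m] by blast
next
  assume "\<exists>V. direct_sum m U V \<and> W = U m \<boxplus> V \<and> U m \<inter> V = {0}"
  then obtain V where V: "V = {\<Sum>i<m. w i | w. \<forall>i<m. w i \<in> U i}"
    and indep: "\<And>w i. (\<forall>i<m. w i \<in> U i) \<Longrightarrow> (\<Sum>i<m. w i) = 0 \<Longrightarrow> i < m \<Longrightarrow> w i = 0"
    and W: "W = U m \<boxplus> V" and int: "U m \<inter> V = {0}"
    unfolding direct_sum_def by blast
  show "direct_sum (Suc m) U W"
    unfolding direct_sum_def
  proof (intro conjI allI impI)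
    show "W = {\<Sum>i<Suc m. w i | w. \<forall>i<Suc m. w i \<in> U i}"
    proof
      show "W \<subseteq> {\<Sum>i<Suc m. w i | w. \<forall>i<Suc m. w i \<in> U i}"
      proof
        fix x assume "x \<in> W"
        then obtain u w where w: "u \<in> U m" "x = u + (\<Sum>i<m. w i)" "\<forall>i<m. w i \<in> U i"
          unfolding W V by blast
        have "x = (\<Sum>i<Suc m. (w(m := u)) i)" "\<forall>i<Suc m. (w(m := u)) i \<in> U i"
          using w by (auto simp: add.commute less_Suc_eq intro!: sum.cong)
        then show "x \<in> {\<Sum>i<Suc m. w i | w. \<forall>i<Suc m. w i \<in> U i}" unfolding mem_Collect_eq by metis
      qed
      show "{\<Sum>i<Suc m. w i | w. \<forall>i<Suc m. w i \<in> U i} \<subseteq> W"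
        unfolding W V by (auto simp: add.commute) (metis less_Suc_eq)
    qed
    fix w i assume w: "(\<forall>i<Suc m. w i \<in> U i) \<and> (\<Sum>i<Suc m. w i) = 0" "i < Suc m"
    then have "w m = - (\<Sum>i<m. w i)" by (simp add: eq_neg_iff_add_eq_0 add.commute)
    also have "\<dots> = (\<Sum>i<m. - w i)" by (simp add: sum_negf)
    also have "\<dots> \<in> V"
    proof -
      have "\<forall>i<m. - w i \<in> U i" using w U by (metis invariant_subspaceD less_Suc_eq less_imp_le subspace_neg)
      then show ?thesis unfolding V by blast
    qed
    finally have "w m = 0" using w int by blast
    moreover have "w i = 0" if "i < m"
      using indep[of w i] w \<open>w m = 0\<close> that by simp
    ultimately show "w i = 0" using w(2) by (auto simp: less_Suc_eq)
  qed
qed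

lemma direct_sum_cong:
  assumes "\<And>i. i < m \<Longrightarrow> U i = U' i"
  shows "direct_sum m U W \<longleftrightarrow> direct_sum m U' W"
proof -
  have "(\<forall>i<m. w i \<in> U i) \<longleftrightarrow> (\<forall>i<m. w i \<in> U' i)" for w
    using assms by simp
  then show ?thesis unfolding direct_sum_def by simp
qed

theorem is_elementary_divisors_iff_decomp:
  "is_elementary_divisors scale T W M \<longleftrightarrow> primary_decomp W M"
proof
  assume "is_elementary_divisors scale T W M"
  then obtain m U p k where dir: "direct_sum m U W"
    and cyc: "\<And>i. i < m \<Longrightarrow> primary_cyclic (U i) (p i ^ k i)"
    and M: "M = image_mset (\<lambda>i. p i ^ k i) (mset_set {..<m})"
    unfolding is_elementary_divisors_def isomorphic_to_quotient_iff_cyclic primary_cyclic_def by blast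
  show "primary_decomp W M"
    using dir cyc unfolding M
  proof (induction m arbitrary: W)
    case 0
    then have "W = {0}" by (simp add: direct_sum_def)
    then show ?case using primary_decomp_zero by simp
  next
    case (Suc m)
    obtain V where V: "direct_sum m U V" "W = U m \<boxplus> V" "U m \<inter> V = {0}"
    proof -
      have "invariant (U i)" if "i \<le> m" for i
        using Suc.prems(2) primary_cyclic_invariant that by (meson le_imp_less_Suc)
      from direct_sum_Suc[of m U W, OF this] show thesis
        using Suc.prems(1) that by blast
    qed
    have "primary_decomp (U m \<boxplus> V) (add_mset (p m ^ k m) (image_mset (\<lambda>i. p i ^ k i) (mset_set {..<m})))"
      using Suc V by (intro primary_decomp_add) auto
    then show ?case using V(2) by (simp add: lessThan_Suc)
  qed
next
  assume "primary_decomp W M"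
  then show "is_elementary_divisors scale T W M"
  proof (induction rule: primary_decomp.induct)
    case primary_decomp_zero
    show ?case
      unfolding is_elementary_divisors_def by (rule exI[of _ 0]) (simp add: direct_sum_def)
  next
    case (primary_decomp_add W M C q)
    then obtain m U p k where dir: "direct_sum m U W"
      and cyc: "\<forall>i<m. indecomposable scale T (U i) \<and> monic (p i) \<and> irreducible (p i) \<and> 0 < k i \<and>
           isomorphic_to_quotient scale T (U i) (p i ^ k i)"
      and M: "M = image_mset (\<lambda>i. p i ^ k i) (mset_set {..<m})"
      unfolding is_elementary_divisors_def by blast
    obtain v p' k' where C: "C = cyc v" "has_order v q" "q = p' ^ k'" "irreducible p'" "monic p'" "0 < k'"
      using primary_decomp_add.hyps(2) unfolding primary_cyclic_def by blast
    have ind: "indecomposable scale T C"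
      using indecomposable_cyc C by metis
    let ?U = "U(m := C)" and ?p = "p(m := p')" and ?k = "k(m := k')"
    have "invariant (?U i)" if "i \<le> m" for i
      using that cyc primary_cyclic_invariant[OF primary_decomp_add.hyps(2)] by (auto simp: indecomposable_def)
    moreover have "direct_sum m ?U W"
      using dir direct_sum_cong[of m U ?U] by simp
    ultimately have "direct_sum (Suc m) ?U (C \<boxplus> W)"
      using direct_sum_Suc[of m ?U] primary_decomp_add.hyps(3) by auto
    moreover have "\<forall>i<Suc m. indecomposable scale T (?U i) \<and> monic (?p i) \<and> irreducible (?p i) \<and> 0 < ?k i \<and>
           isomorphic_to_quotient scale T (?U i) (?p i ^ ?k i)"
      using cyc ind C isomorphic_to_quotient_iff_cyclic[of C q] by (auto simp: less_Suc_eq)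
    moreover have "add_mset q M = image_mset (\<lambda>i. ?p i ^ ?k i) (mset_set {..<Suc m})"
    proof -
      have "M = image_mset (\<lambda>i. ?p i ^ ?k i) (mset_set {..<m})"
        unfolding M by (rule image_mset_cong) auto
      then show ?thesis by (simp add: lessThan_Suc C(3))
    qed
    ultimately show ?case
      unfolding is_elementary_divisors_def
      by (intro exI[of _ "Suc m"] exI[of _ ?U] exI[of _ ?p] exI[of _ ?k]) simp
  qed
qed

definition kernel :: "'a poly \<Rightarrow> 'b set \<Rightarrow> 'b set"
  where "kernel g W = {w \<in> W. g \<star> w = 0}"

lemma invariant_kernel: "invariant W \<Longrightarrow> invariant (kernel g W)"
  by (rule invariantI)
    (auto simp: kernel_def act_add_right zero_in_invariant invariant_act act_commute[of g]
      intro: subspace_add[OF invariant_subspaceD])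

lemma dim_kernel_sum:
  assumes "invariant U" "invariant W" "U \<inter> W = {0}"
  shows "dim (kernel g (U \<boxplus> W)) = dim (kernel g U) + dim (kernel g W)"
proof -
  have "kernel g (U \<boxplus> W) = kernel g U \<boxplus> kernel g W"
  proof
    show "kernel g U \<boxplus> kernel g W \<subseteq> kernel g (U \<boxplus> W)"
      by (auto simp: kernel_def act_add_right)
    show "kernel g (U \<boxplus> W) \<subseteq> kernel g U \<boxplus> kernel g W"
    proof
      fix x assume "x \<in> kernel g (U \<boxplus> W)"
      then obtain u w where uw: "x = u + w" "u \<in> U" "w \<in> W" "g \<star> u + g \<star> w = 0 + 0"
        by (auto simp: kernel_def act_add_right)
      then have "g \<star> u = 0" "g \<star> w = 0"
        using set_sum_unique[OF assms, of "g \<star> u" 0 "g \<star> w" 0] assms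
          invariant_act zero_in_invariant by blast+
      then show "x \<in> kernel g U \<boxplus> kernel g W" using uw by (auto simp: kernel_def)
    qed
  qed
  moreover have "kernel g U \<inter> kernel g W = {0}"
  proof -
    have "kernel g U \<inter> kernel g W \<subseteq> U \<inter> W" by (auto simp only: kernel_def)
    then show ?thesis
      using assms(3) zero_in_invariant[OF invariant_kernel[OF assms(1)]] zero_in_invariant[OF invariant_kernel[OF assms(2)]]
      by blast
  qed
  ultimately show ?thesis
    using dim_direct_sum[OF invariant_subspaceD[OF invariant_kernel[OF assms(1)]] invariant_subspaceD[OF invariant_kernel[OF assms(2)]]]
    by simp
qed

text \<open>Inside a cyclic space of order \<open>p\<^sup>k\<close> the kernel of \<open>p\<^sup>j\<close> is the orbit of \<open>p\<^sup>l v\<close>, where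
  \<open>l = k - min j k\<close>, and that vector has order \<open>p\<close> to the power \<open>min j k\<close>.\<close>

lemma dim_kernel_cyc_same:
  assumes p: "irreducible p" and ord: "has_order v (p ^ k)"
  shows "dim (kernel (p ^ j) (cyc v)) = min j k * degree p"
proof -
  have "p \<noteq> 0" using p by auto
  define l where "l = k - min j k"
  have k: "p ^ k = p ^ min j k * p ^ l" by (simp add: l_def power_add[symmetric])
  have "kernel (p ^ j) (cyc v) = cyc (p ^ l \<star> v)"
  proof
    show "kernel (p ^ j) (cyc v) \<subseteq> cyc (p ^ l \<star> v)"
    proof
      fix w assume "w \<in> kernel (p ^ j) (cyc v)"
      then obtain g where g: "w = g \<star> v" "p ^ k dvd p ^ j * g"
        using has_orderD[OF ord] by (auto simp: kernel_def act_mult[symmetric])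
      have "p ^ l dvd g"
      proof (cases "j \<le> k")
        case True
        then show ?thesis using g(2) \<open>p \<noteq> 0\<close> unfolding k by (simp add: min_def)
      qed (simp add: l_def)
      then obtain h where "g = h * p ^ l" unfolding dvd_def by (metis mult.commute)
      then show "w \<in> cyc (p ^ l \<star> v)" using g(1) by (auto simp: act_mult)
    qed
    show "cyc (p ^ l \<star> v) \<subseteq> kernel (p ^ j) (cyc v)"
    proof
      fix w assume "w \<in> cyc (p ^ l \<star> v)"
      then obtain g where g: "w = (g * p ^ l) \<star> v" by (auto simp: act_mult)
      have "p ^ k dvd p ^ j * (g * p ^ l)"
        unfolding k by (metis dvd_triv_right le_imp_power_dvd min.cobounded1 mult.left_commute mult_dvd_mono)
      then show "w \<in> kernel (p ^ j) (cyc v)"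
        using g has_orderD[OF ord] by (auto simp: kernel_def act_mult[symmetric])
    qed
  qed
  moreover have "has_order (p ^ l \<star> v) (p ^ min j k)"
    unfolding has_order_def
  proof
    fix g
    have "g \<star> p ^ l \<star> v = 0 \<longleftrightarrow> p ^ min j k * p ^ l dvd g * p ^ l"
      using has_orderD[OF ord, of "g * p ^ l"] by (simp add: act_mult k)
    then show "g \<star> p ^ l \<star> v = 0 \<longleftrightarrow> p ^ min j k dvd g"
      using \<open>p \<noteq> 0\<close> by simp
  qed
  ultimately show ?thesis
    using dim_cyc \<open>p \<noteq> 0\<close> by (simp add: degree_power_eq)
qed

text \<open>A nonzero kernel would contain the minimal invariant subspace, and then \<open>r\<close> would divide a power
  of \<open>p\<close>.\<close>

lemma dim_kernel_cyc_other:
  assumes p: "irreducible p" "monic p" and r: "irreducible r" "monic r" and "p \<noteq> r"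
    and ord: "has_order v (r ^ k)" "0 < k"
  shows "dim (kernel (p ^ j) (cyc v)) = 0"
proof -
  have "kernel (p ^ j) (cyc v) = {0}"
  proof (rule ccontr)
    assume "kernel (p ^ j) (cyc v) \<noteq> {0}"
    then have "r ^ (k - 1) \<star> v \<in> kernel (p ^ j) (cyc v)"
      by (intro socle_in_invariant_subspace[OF r(1) ord(1) invariant_kernel[OF invariant_cyc]])
        (auto simp: kernel_def)
    then have "r ^ k dvd p ^ j * r ^ (k - 1)"
      using has_orderD[OF ord(1)] by (simp add: kernel_def act_mult[symmetric])
    moreover have "r ^ k = r * r ^ (k - 1)" using ord(2) by (metis power_eq_if not_gr_zero)
    moreover have "r \<noteq> 0" using r(1) by auto
    ultimately have "r dvd p ^ j" by simp
    then show False using monic_irreducible_power_dvd_eq r p assms(5) by metis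
  qed
  then show ?thesis by simp
qed

text \<open>The kernel of \<open>p\<^sup>j\<close> on a summand of order \<open>p\<^sup>l\<close> has dimension \<open>min j l\<close> times the degree of \<open>p\<close>, and
  the second difference of \<open>min j l\<close> in \<open>j\<close> is supported at \<open>j = l\<close>; all other summands contribute
  nothing. The identity is written without subtraction to stay within the natural numbers.\<close>

theorem primary_decomp_multiplicity:
  assumes "primary_decomp W M" and p: "irreducible p" "monic p" and "0 < k"
  shows "2 * dim (kernel (p ^ k) W) =
    dim (kernel (p ^ (k - 1)) W) + dim (kernel (p ^ (k + 1)) W) + degree p * count M (p ^ k)"
  using assms(1)
proof (induction rule: primary_decomp.induct)
  case primary_decomp_zero
  have zero: "kernel g {0} = {0}" for g by (auto simp: kernel_def)
  show ?case unfolding zero by simp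
next
  case (primary_decomp_add W M U q)
  obtain v r l where U: "U = cyc v" "has_order v (r ^ l)" "q = r ^ l" "irreducible r" "monic r" "0 < l"
    using primary_decomp_add.hyps(2) unfolding primary_cyclic_def by blast
  have "2 * dim (kernel (p ^ k) U) =
    dim (kernel (p ^ (k - 1)) U) + dim (kernel (p ^ (k + 1)) U) + degree p * (if q = p ^ k then 1 else 0)"
  proof (cases "p = r")
    case True
    have "q = p ^ k \<longleftrightarrow> l = k"
      using monic_irreducible_power_eq_iff[OF U(4,5) p U(6), of k] True U(3) by simp
    then have min: "2 * min k l = min (k - 1) l + min (k + 1) l + (if q = p ^ k then 1 else 0)"
      using \<open>0 < k\<close> by auto
    have dim: "dim (kernel (p ^ j) U) = degree p * min j l" for j
      using dim_kernel_cyc_same[OF U(4,2)] True U(1) by (simp add: mult.commute)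
    have "2 * (degree p * min k l) = degree p * (2 * min k l)" by simp
    then show ?thesis unfolding dim min by (simp only: distrib_left)
  next
    case False
    then have "q \<noteq> p ^ k"
      using monic_irreducible_power_eq_iff[OF U(4,5) p U(6), of k] U(3) by auto
    moreover have zero: "dim (kernel (p ^ j) U) = 0" for j
      unfolding U(1) by (rule dim_kernel_cyc_other[OF p U(4,5) False U(2,6)])
    ultimately show ?thesis unfolding zero by (simp del: dim_eq_0)
  qed
  then show ?case
    using primary_decomp_add.IH
      dim_kernel_sum[OF primary_cyclic_invariant[OF primary_decomp_add.hyps(2)] primary_decomp_invariant[OF primary_decomp_add.hyps(1)] primary_decomp_add.hyps(3)]
    by (auto simp: algebra_simps)
qed

end

section \<open>Dual polynomials and the adjoint\<close>

locale involution =
  fixes J :: "'a::field \<Rightarrow> 'a"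
  assumes J: "involutory_automorphism J"
begin

lemma J_add: "J (a + b) = J a + J b"
  and J_mult: "J (a * b) = J a * J b"
  and J_J [simp]: "J (J a) = a"
  using J by (auto simp: involutory_automorphism_def)

lemma J_0 [simp]: "J 0 = 0"
  using J_add[of 0 0] by (metis add_cancel_left_left add_0)

lemma J_eq_0_iff [simp]: "J a = 0 \<longleftrightarrow> a = 0"
  by (metis J_0 J_J)

lemma J_1 [simp]: "J 1 = 1"
  using J_mult[of 1 1] by simp

lemma J_minus: "J (- a) = - J a"
  using J_add[of a "- a"] by (simp add: eq_neg_iff_add_eq_0 add.commute)

lemma J_diff: "J (a - b) = J a - J b"
  using J_add[of a "- b"] by (simp add: J_minus)

lemma field_hom_J: "field_hom J"
  by unfold_locales (simp_all add: J_add J_mult)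

lemma J_inverse: "J (inverse a) = inverse (J a)"
  by (rule field_hom.hom_inverse[OF field_hom_J])

lemma coeff_map_J: "coeff (map_poly J f) i = J (coeff f i)"
  by (rule coeff_map_poly) simp

lemma degree_map_J: "degree (map_poly J f) = degree f"
  by (rule degree_map_poly) simp

lemma map_J_mult: "map_poly J (f * g) = map_poly J f * map_poly J g"
proof -
  interpret field_hom J by (rule field_hom_J)
  interpret mp: map_poly_comm_ring_hom J ..
  show ?thesis by (rule mp.hom_mult)
qed

lemma map_J_smult: "map_poly J (Polynomial.smult c f) = Polynomial.smult (J c) (map_poly J f)"
  by (rule poly_eqI) (simp add: coeff_map_J J_mult)

lemma map_J_pCons: "map_poly J (pCons a f) = pCons (J a) (map_poly J f)"
  by (rule poly_eqI) (simp add: coeff_map_J coeff_pCons split: nat.split)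

lemma map_J_map_J: "map_poly J (map_poly J f) = f"
  by (rule poly_eqI) (simp add: coeff_map_J)

lemma map_J_reflect: "map_poly J (reflect_poly f) = reflect_poly (map_poly J f)"
  by (rule poly_eqI) (simp add: coeff_map_J coeff_reflect_poly degree_map_J)

lemma dual_mult: "dual_poly J (f * g) = dual_poly J f * dual_poly J g"
  by (simp add: dual_poly_def map_J_mult reflect_poly_mult J_mult mult.commute)

lemma dual_1: "dual_poly J 1 = 1"
  by (simp add: dual_poly_def map_poly_1')

lemma dual_power: "dual_poly J (f ^ n) = dual_poly J f ^ n"
  by (induction n) (simp_all add: dual_1 dual_mult)

lemma monic_dual: "poly f 0 \<noteq> 0 \<Longrightarrow> monic (dual_poly J f)"
  and degree_dual: "poly f 0 \<noteq> 0 \<Longrightarrow> degree (dual_poly J f) = degree f"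
  by (simp_all add: dual_poly_def coeff_reflect_poly degree_reflect_poly_eq coeff_map_J degree_map_J poly_0_coeff_0)

lemma poly_dual_0: "monic f \<Longrightarrow> poly (dual_poly J f) 0 = inverse (J (poly f 0))"
  by (simp add: dual_poly_def coeff_map_J degree_map_J)

lemma dual_dual:
  assumes "monic f" "poly f 0 \<noteq> 0"
  shows "dual_poly J (dual_poly J f) = f"
proof -
  have "coeff f 0 \<noteq> 0" using assms(2) by (simp add: poly_0_coeff_0)
  have "dual_poly J (dual_poly J f) =
      Polynomial.smult (poly f 0) (reflect_poly (map_poly J (dual_poly J f)))"
    unfolding dual_poly_def[of J "dual_poly J f"] poly_dual_0[OF assms(1)]
    by (simp add: J_inverse)
  also have "\<dots> = f"
    unfolding dual_poly_def map_J_smult map_J_reflect reflect_poly_smult map_J_map_J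
    using assms(2) \<open>coeff f 0 \<noteq> 0\<close> by (simp add: J_inverse)
  finally show ?thesis .
qed

text \<open>Duality is multiplicative, preserves degrees and is an involution, so a factorization of the dual
  gives one of \<open>p\<close>.\<close>

lemma irreducible_dual:
  assumes "irreducible p" "monic p" "poly p 0 \<noteq> 0"
  shows "irreducible (dual_poly J p)"
proof -
  have deg: "degree (dual_poly J p) = degree p" by (rule degree_dual[OF assms(3)])
  have pos: "0 < degree p" by (rule irreducible_poly_degree_pos[OF assms(1)])
  show ?thesis
  proof (rule irreducibleI)
    show "dual_poly J p \<noteq> 0" using deg pos by auto
    show "\<not> is_unit (dual_poly J p)" using deg pos by (auto simp: poly_dvd_1)
    fix a b assume ab: "dual_poly J p = a * b"
    then have eq: "p = dual_poly J a * dual_poly J b"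
      using dual_dual[OF assms(2,3)] dual_mult by metis
    have "poly a 0 \<noteq> 0" "poly b 0 \<noteq> 0"
      using poly_dual_0[OF assms(2)] assms(3) unfolding ab by auto
    then have "degree (dual_poly J a) = degree a" "degree (dual_poly J b) = degree b" "a \<noteq> 0" "b \<noteq> 0"
      using degree_dual by auto
    moreover have "is_unit (dual_poly J a) \<or> is_unit (dual_poly J b)"
      using irreducibleD[OF assms(1) eq] .
    ultimately show "is_unit a \<or> is_unit b"
      by (auto simp: poly_dvd_1 is_unit_iff_degree)
  qed
qed

end

locale invertible_endo = linear_endo scale Basis T + involution J
  for scale :: "'a::field \<Rightarrow> 'b::ab_group_add \<Rightarrow> 'b" (infixr \<open>*s\<close> 75)
    and Basis :: "'b set" and T :: "'b \<Rightarrow> 'b" and J :: "'a \<Rightarrow> 'a" +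
  assumes bij_T: "bij T"
begin

abbreviation Tinv :: "'b \<Rightarrow> 'b"
  where "Tinv \<equiv> inv_into UNIV T"

lemma T_inv [simp]: "T (Tinv v) = v"
  and inv_T [simp]: "Tinv (T v) = v"
  using bij_T by (simp_all add: bij_is_surj surj_f_inv_f bij_is_inj)

lemma T_eq_0_iff: "T v = 0 \<longleftrightarrow> v = 0"
  by (metis T_zero inv_T)

lemma linear_Tinv: "Vector_Spaces.linear scale scale Tinv"
proof -
  have 1: "Tinv (u + v) = Tinv u + Tinv v" for u v
    by (metis T_add T_inv inv_T)
  have 2: "Tinv (c *s v) = c *s Tinv v" for c v
    by (metis T_scale T_inv inv_T)
  show ?thesis by unfold_locales (simp_all add: 1 2)
qed

sublocale inverse: linear_endo scale Basis Tinv
  by (intro linear_endo.intro linear_endo_axioms.intro finite_dimensional_vector_space_axioms linear_Tinv)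

text \<open>The adjoint of \<open>g(T)\<close> for any \<open>T\<close>-invariant \<open>J\<close>-sesquilinear form.\<close>

definition adj :: "'a poly \<Rightarrow> 'b \<Rightarrow> 'b"
  where "adj g v = apply_poly scale (map_poly J g) Tinv v"

lemma adj_0 [simp]: "adj 0 v = 0"
  by (simp add: adj_def)

lemma adj_pCons: "adj (pCons a g) v = J a *s v + Tinv (adj g v)"
  by (simp add: adj_def map_J_pCons inverse.act_pCons)

lemma adj_mult: "adj (g * h) v = adj g (adj h v)"
  by (simp add: adj_def map_J_mult inverse.act_mult)

lemma adj_Tinv: "adj g (Tinv v) = Tinv (adj g v)"
  by (simp add: adj_def inverse.act_T)

lemma T_power_inv: "i \<le> n \<Longrightarrow> (T ^^ n) ((Tinv ^^ i) v) = (T ^^ (n - i)) v"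
proof (induction i arbitrary: n)
  case (Suc i)
  then obtain m where "n = Suc m" by (cases n) auto
  then show ?case using Suc by (simp add: funpow_swap1[of T])
qed simp

lemma T_power_linear: "(T ^^ n) (sum f A) = (\<Sum>a\<in>A. (T ^^ n) (f a))"
  "(T ^^ n) (c *s v) = c *s (T ^^ n) v"
  "(T ^^ n) v = 0 \<longleftrightarrow> v = 0"
  by (induction n) (simp_all add: T_sum T_scale T_eq_0_iff)

text \<open>Substituting \<open>1/x\<close> for \<open>x\<close> in a polynomial and clearing denominators corresponds to replacing \<open>T\<close> by
  its inverse and multiplying by a power of \<open>T\<close>.\<close>

lemma reflect_act: "reflect_poly h \<star> v = (T ^^ degree h) (apply_poly scale h Tinv v)"
proof -
  let ?n = "degree h"
  have "reflect_poly h \<star> v = (\<Sum>j\<le>?n. coeff (reflect_poly h) j *s (T ^^ j) v)"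
    by (rule act_bound[OF degree_reflect_poly_le])
  also have "\<dots> = (\<Sum>i\<le>?n. coeff h i *s (T ^^ (?n - i)) v)"
    by (rule sum.reindex_bij_witness[of _ "\<lambda>i. ?n - i" "\<lambda>i. ?n - i"]) (auto simp: coeff_reflect_poly)
  also have "\<dots> = (T ^^ ?n) (apply_poly scale h Tinv v)"
    unfolding apply_poly_def by (simp add: T_power_linear T_power_inv)
  finally show ?thesis .
qed

lemma adj_eq_0_iff: "poly g 0 \<noteq> 0 \<Longrightarrow> adj g v = 0 \<longleftrightarrow> dual_poly J g \<star> v = 0"
  by (simp add: dual_poly_def act_smult reflect_act T_power_linear adj_def)

text \<open>An irreducible polynomial with root \<open>0\<close> is a scalar multiple of \<open>x\<close>, and \<open>T\<close> is injective.\<close>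

lemma prime_factor_nonzero_at_0:
  assumes "irreducible p" "has_order v (p ^ k)" "0 < k"
  shows "poly p 0 \<noteq> 0"
proof
  assume "poly p 0 = 0"
  then obtain r where r: "p = [:0, 1:] * r"
    using poly_eq_0_iff_dvd[of p 0] unfolding dvd_def by auto
  have "\<not> is_unit [:0, 1::'a:]" by (simp add: poly_dvd_1)
  then have "is_unit r" using irreducibleD[OF assms(1) r] by blast
  then obtain s where s: "1 = r * s" unfolding dvd_def by blast
  define z where "z = p ^ (k - 1) \<star> v"
  have "z \<noteq> 0" unfolding z_def by (rule prime_power_pred_act_nonzero[OF assms])
  have "p \<star> z = p ^ k \<star> v"
    using assms(3) by (simp add: z_def act_mult[symmetric] power_eq_if)
  then have "p \<star> z = 0" using has_orderD[OF assms(2)] by simp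
  have "T z = ([:0, 1:] * (r * s)) \<star> z" by (simp only: s[symmetric] mult_1_right act_x)
  also have "\<dots> = s \<star> p \<star> z" unfolding r by (simp only: act_mult[symmetric] mult_ac)
  finally show False using \<open>p \<star> z = 0\<close> \<open>z \<noteq> 0\<close> by (simp add: T_eq_0_iff)
qed

lemma sesquilinear_formD:
  assumes "sesquilinear_form scale J H"
  shows "H (u + u') v = H u v + H u' v" "H u (v + v') = H u v + H u v'"
    "H (a *s u) v = J a * H u v" "H u (a *s v) = a * H u v" "H 0 v = 0"
proof -
  have scale: "H (a *s u) (b *s v) = J a * b * H u v" for a b u v
    using assms unfolding sesquilinear_form_def by blast
  show "H (u + u') v = H u v + H u' v" "H u (v + v') = H u v + H u v'"
    using assms unfolding sesquilinear_form_def by blast+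
  show "H (a *s u) v = J a * H u v" "H u (a *s v) = a * H u v" "H 0 v = 0"
    using scale[of a u 1 v] scale[of 1 u a v] scale[of 0 u 1 v] by simp_all
qed

lemma sesquilinear_form_act:
  assumes H: "sesquilinear_form scale J H" and inv: "invariant_form T H"
  shows "H (g \<star> u) v = H u (adj g v)"
proof (induction g arbitrary: v)
  case 0
  show ?case
    using sesquilinear_formD(4)[OF H, of u 0 v] by (simp add: sesquilinear_formD(5)[OF H])
next
  case (pCons a g)
  have T: "H (T x) y = H x (Tinv y)" for x y
    using inv unfolding invariant_form_def by (metis T_inv)
  show ?case
    by (simp add: act_pCons adj_pCons sesquilinear_formD[OF H] T pCons.IH adj_Tinv)
qed

text \<open>Extend a basis \<open>B\<close> of \<open>ker g(T)\<close> to a basis \<open>E\<close> of the space. The image of \<open>g(T)\<close> is spanned by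
  the vectors \<open>g(T) b\<close> for \<open>b\<close> in \<open>E - B\<close>, so its orthogonal complement has dimension at
  least \<open>card B\<close>. By non-degeneracy that complement lies in the kernel of the adjoint.\<close>

lemma dim_kernel_le_dim_kernel_dual:
  assumes H: "sesquilinear_form scale J H" and inv: "invariant_form T H" and nondeg: "nondegenerate_form H"
    and g: "poly g 0 \<noteq> 0"
  shows "dim (kernel g UNIV) \<le> dim (kernel (dual_poly J g) UNIV)"
proof -
  have right: "functional (H u)" for u
    unfolding functional_def by (simp add: sesquilinear_formD[OF H])
  have left: "subspace {u. H u v = 0}" for v
    by (rule subspaceI) (simp_all add: sesquilinear_formD[OF H])
  have sub: "subspace (kernel g UNIV)"
    using subspace_kernel by (simp add: kernel_def)
  obtain B where B: "B \<subseteq> kernel g UNIV" "independent B" "card B = dim (kernel g UNIV)"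
    by (metis basis_subspace_exists[OF sub])
  define E where "E = extend_basis B"
  have E: "B \<subseteq> E" "independent E" "span E = UNIV"
    using extend_basis_superset independent_extend_basis span_extend_basis B(2) by (auto simp: E_def)
  have fin: "finite E" by (rule finiteI_independent[OF E(2)])
  have cardE: "card E = dim (UNIV :: 'b set)" using dim_eq_card[of E UNIV] E by simp
  let ?F = "(\<lambda>b. H (g \<star> b)) ` (E - B)"
  have "dim (UNIV :: 'b set) \<le> dim {w \<in> UNIV. \<forall>l\<in>?F. l w = 0} + card ?F"
    by (rule dim_le_dim_annihilated) (use fin right in auto)
  moreover have "card ?F \<le> card (E - B)" by (rule card_image_le) (use fin in simp)
  moreover have "card (E - B) = card E - card B"
    using E(1) fin by (intro card_Diff_subset) (auto intro: finite_subset)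
  moreover have "card B \<le> card E" by (rule card_mono[OF fin E(1)])
  moreover have "dim {w \<in> UNIV. \<forall>l\<in>?F. l w = 0} \<le> dim (kernel (dual_poly J g) UNIV)"
  proof (rule dim_subset, rule subsetI)
    fix w assume w: "w \<in> {w \<in> UNIV. \<forall>l\<in>?F. l w = 0}"
    have "E \<subseteq> {u. H u (adj g w) = 0}"
    proof
      fix b assume b: "b \<in> E"
      have "H (g \<star> b) w = 0"
      proof (cases "b \<in> B")
        case True
        then have "g \<star> b = 0" using B(1) by (auto simp: kernel_def)
        then show ?thesis using subspace_0[OF left] by simp
      qed (use b w in auto)
      then show "b \<in> {u. H u (adj g w) = 0}" by (simp add: sesquilinear_form_act[OF H inv])
    qed
    then have "span E \<subseteq> {u. H u (adj g w) = 0}" using left by (rule span_minimal)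
    then have "\<forall>u. H u (adj g w) = 0" unfolding E(3) by blast
    then have "adj g w = 0" using nondeg unfolding nondegenerate_form_def by blast
    then show "w \<in> kernel (dual_poly J g) UNIV"
      using adj_eq_0_iff[OF g] by (simp add: kernel_def)
  qed
  ultimately show ?thesis using B(3) cardE by linarith
qed

text \<open>As the dual of the dual of \<open>p\<close> is \<open>p\<close>, the inequality of kernel dimensions holds in both
  directions, and the dimensions determine the multiplicities.\<close>

theorem form_imp_closed_under_dual:
  assumes H: "sesquilinear_form scale J H" and inv: "invariant_form T H" and nondeg: "nondegenerate_form H"
    and M: "primary_decomp UNIV M"
  shows "elementary_divisors_closed_under_dual J M"
  unfolding elementary_divisors_closed_under_dual_def
proof (intro allI impI disjI2)
  fix q assume "q \<in># M"
  then obtain v p k where v: "v \<in> UNIV" "has_order v q" "q = p ^ k" "irreducible p" "monic p" "0 < k"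
    by (rule primary_decomp_element[OF M])
  have p0: "poly p 0 \<noteq> 0"
    using prime_factor_nonzero_at_0[OF v(4) _ v(6)] v(2,3) by blast
  let ?r = "dual_poly J p"
  have r: "irreducible ?r" "monic ?r" "degree ?r = degree p" "poly ?r 0 \<noteq> 0"
    using irreducible_dual[OF v(4,5) p0] monic_dual[OF p0] degree_dual[OF p0] poly_dual_0[OF v(5)] p0
    by auto
  have dim: "dim (kernel (?r ^ j) UNIV) = dim (kernel (p ^ j) UNIV)" for j
  proof (rule antisym)
    show "dim (kernel (?r ^ j) UNIV) \<le> dim (kernel (p ^ j) UNIV)"
      using dim_kernel_le_dim_kernel_dual[OF H inv nondeg, of "?r ^ j"] r(4)
      by (simp add: dual_power dual_dual[OF v(5) p0])
    show "dim (kernel (p ^ j) UNIV) \<le> dim (kernel (?r ^ j) UNIV)"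
      using dim_kernel_le_dim_kernel_dual[OF H inv nondeg, of "p ^ j"] p0
      by (simp add: dual_power)
  qed
  have "degree p * count M (?r ^ k) = degree p * count M (p ^ k)"
    using primary_decomp_multiplicity[OF M v(4-6)] primary_decomp_multiplicity[OF M r(1,2) v(6)]
    unfolding dim r(3) by linarith
  then have "count M (dual_poly J q) = count M q"
    using irreducible_poly_degree_pos[OF v(4)] by (simp add: v(3) dual_power)
  then show "dual_poly J q \<in># M \<and> count M (dual_poly J q) = count M q"
    using \<open>q \<in># M\<close> by (metis count_greater_zero_iff)
qed

end

section \<open>Construction of invariant forms\<close>

lemma (in involution) skew_scalar:
  assumes "J \<noteq> id"
  obtains c where "c \<noteq> 0" "J c = - c"
proof -
  obtain a where "J a \<noteq> a" using assms by fastforce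
  then have "a - J a \<noteq> 0" by simp
  moreover have "J (a - J a) = - (a - J a)" by (simp add: J_diff)
  ultimately show thesis by (rule that)
qed

lemma two_neq_0:
  assumes "CHAR('a::field) \<noteq> 2"
  shows "(2::'a) \<noteq> 0"
proof
  assume "(2::'a) = 0"
  then have "of_nat 2 = (0::'a)" by simp
  then have "CHAR('a) dvd 2" by (simp only: of_nat_eq_0_iff_char_dvd)
  then have "CHAR('a) \<le> 2" "CHAR('a) \<noteq> 0" by (auto intro: dvd_imp_le gr0I)
  then have "CHAR('a) = 1" using assms by linarith
  then have "of_nat 1 = (0::'a)" by (metis dvd_refl of_nat_eq_0_iff_char_dvd)
  then show False by simp
qed

context linear_endo begin

lemma invariant_image_eq:
  assumes "inj T" "invariant N"
  shows "T ` N = N"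
proof -
  interpret pair: finite_dimensional_vector_space_pair scale Basis scale Basis ..
  have N: "subspace N" "T ` N \<subseteq> N" using assms(2) by (auto simp: invariant_subspace_def)
  have "subspace (T ` N)"
    by (rule pair.linear_subspace_image[OF linear_T N(1)])
  moreover have "dim (T ` N) = dim N"
    using assms(1) by (intro pair.dim_image_eq[OF linear_T]) (auto intro: inj_on_subset)
  ultimately show ?thesis using N by (intro subspace_dim_equal) auto
qed

end

context invertible_endo begin

text \<open>In finite dimension an injective map sends an invariant subspace onto itself.\<close>

lemma invariant_Tinv:
  assumes "invariant W" "w \<in> W"
  shows "Tinv w \<in> W"
proof -
  have "w \<in> T ` W"
    using invariant_image_eq[OF bij_is_inj[OF bij_T] assms(1)] assms(2) by simp
  then show ?thesis by auto
qed

lemma invariant_T: "invariant W \<Longrightarrow> w \<in> W \<Longrightarrow> T w \<in> W"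
  by (auto simp: invariant_subspace_def)

lemma invariant_add: "invariant W \<Longrightarrow> u \<in> W \<Longrightarrow> v \<in> W \<Longrightarrow> u + v \<in> W"
  and invariant_scale: "invariant W \<Longrightarrow> u \<in> W \<Longrightarrow> c *s u \<in> W"
  by (auto simp: invariant_subspace_def intro: subspace_add subspace_scale)

lemma invariant_adj: "invariant W \<Longrightarrow> w \<in> W \<Longrightarrow> adj g w \<in> W"
  by (induction g) (auto simp: adj_pCons zero_in_invariant intro!: invariant_add invariant_scale invariant_Tinv)

lemma adj_add: "adj g (u + v) = adj g u + adj g v"
  and adj_scale: "adj g (c *s u) = c *s adj g u"
  and adj_diff_left: "adj (g - h) u = adj g u - adj h u"
  and adj_add_left: "adj (g + h) u = adj g u + adj h u"
  and adj_smult: "adj (Polynomial.smult c g) u = J c *s adj g u"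
proof -
  have "map_poly J (g - h) = map_poly J g - map_poly J h" "map_poly J (g + h) = map_poly J g + map_poly J h"
    by (rule poly_eqI, simp add: coeff_map_J J_diff J_add)+
  then show "adj g (u + v) = adj g u + adj g v" "adj g (c *s u) = c *s adj g u"
    "adj (g - h) u = adj g u - adj h u" "adj (g + h) u = adj g u + adj h u"
    "adj (Polynomial.smult c g) u = J c *s adj g u"
    by (simp_all add: adj_def inverse.act_add_right inverse.act_scale inverse.act_diff_left
        inverse.act_add_left map_J_smult inverse.act_smult)
qed

lemma adj_x: "adj ([:0, 1:] * g) u = Tinv (adj g u)"
  by (simp add: adj_pCons)

lemma adj_T: "adj g (T u) = T (adj g u)"
  by (metis T_inv adj_Tinv inv_T)

text \<open>Stated for a form that is additive in its first argument, with scalars twisted by an arbitrary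
  \<open>s\<close>, so that it covers left radicals (\<open>s = J\<close>) as well as right radicals (arguments swapped, \<open>s\<close>
  the identity).\<close>

lemma radical_invariant:
  assumes U: "invariant U" "invariant U'"
    and add: "\<And>u u' v. u \<in> U \<Longrightarrow> u' \<in> U \<Longrightarrow> v \<in> U' \<Longrightarrow> F (u + u') v = F u v + F u' v"
    and scale: "\<And>a u v. u \<in> U \<Longrightarrow> v \<in> U' \<Longrightarrow> F (a *s u) v = s a * F u v"
    and inv: "\<And>u v. u \<in> U \<Longrightarrow> v \<in> U' \<Longrightarrow> F (T u) (T v) = (F u v :: 'a)"
  shows "invariant {u \<in> U. \<forall>v\<in>U'. F u v = 0}"
  unfolding invariant_subspace_def
proof
  have "F 0 v = 0" if "v \<in> U'" for v
    using add[OF _ _ that, of 0 0] zero_in_invariant[OF U(1)] by (metis add_0 add_cancel_left_left)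
  then show "subspace {u \<in> U. \<forall>v\<in>U'. F u v = 0}"
    by (intro subspaceI) (auto simp: zero_in_invariant[OF U(1)] add scale invariant_add[OF U(1)] invariant_scale[OF U(1)])
  have "F (T u) v = 0" if "u \<in> U" "\<forall>v\<in>U'. F u v = 0" "v \<in> U'" for u v
    using inv[OF that(1) invariant_Tinv[OF U(2) that(3)]] that invariant_Tinv[OF U(2)] by simp
  then show "T ` {u \<in> U. \<forall>v\<in>U'. F u v = 0} \<subseteq> {u \<in> U. \<forall>v\<in>U'. F u v = 0}"
    by (auto simp: invariant_T[OF U(1)])
qed

definition pairing :: "'b set \<Rightarrow> 'b set \<Rightarrow> ('b \<Rightarrow> 'b \<Rightarrow> 'a) \<Rightarrow> bool" where
  "pairing U U' B \<longleftrightarrow>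
     (\<forall>u\<in>U. \<forall>u'\<in>U. \<forall>v\<in>U'. B (u + u') v = B u v + B u' v) \<and>
     (\<forall>u\<in>U. \<forall>v\<in>U'. \<forall>v'\<in>U'. B u (v + v') = B u v + B u v') \<and>
     (\<forall>a. \<forall>u\<in>U. \<forall>v\<in>U'. B (a *s u) v = J a * B u v) \<and>
     (\<forall>a. \<forall>u\<in>U. \<forall>v\<in>U'. B u (a *s v) = a * B u v) \<and>
     (\<forall>u\<in>U. \<forall>v\<in>U'. B (T u) (T v) = B u v) \<and>
     (\<forall>u\<in>U. (\<forall>v\<in>U'. B u v = 0) \<longrightarrow> u = 0) \<and>
     (\<forall>v\<in>U'. (\<forall>u\<in>U. B u v = 0) \<longrightarrow> v = 0)"

text \<open>With \<open>v\<close> a generator of \<open>U\<close> and \<open>f\<close> a functional that does not vanish on the minimal invariant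
  subspace of \<open>U'\<close>, put \<open>B (g v) y = f (adj g y)\<close>. This depends only on \<open>g v\<close> because the adjoint of
  \<open>q\<close> kills \<open>U'\<close>. On the right radical \<open>f = B v\<close> vanishes, so that radical is zero. A nonzero left
  radical would contain \<open>p\<^sup>k\<^sup>-\<^sup>1 v\<close>; then \<open>f\<close> would vanish on the invariant subspace
  \<open>adj (p\<^sup>k\<^sup>-\<^sup>1) U'\<close>, so that subspace would be zero, and the dual of \<open>p\<^sup>k\<close> would divide the dual of
  \<open>p\<^sup>k\<^sup>-\<^sup>1\<close>.\<close>

lemma pairing_exists:
  assumes U: "primary_cyclic U q" and U': "primary_cyclic U' (dual_poly J q)"
  shows "\<exists>B. pairing U U' B"
proof -
  obtain v p k where v: "U = cyc v" "has_order v q" "q = p ^ k" "irreducible p" "monic p" "0 < k"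
    using U unfolding primary_cyclic_def by blast
  obtain w r l where w: "U' = cyc w" "has_order w (dual_poly J q)" "dual_poly J q = r ^ l"
      "irreducible r" "monic r" "0 < l"
    using U' unfolding primary_cyclic_def by blast
  have inv: "invariant U" "invariant U'" using v(1) w(1) invariant_cyc by auto
  have ord_v: "has_order v (p ^ k)" and ord_w: "has_order w (r ^ l)"
    using v(2,3) w(2,3) by auto
  have p0: "poly p 0 \<noteq> 0" by (rule prime_factor_nonzero_at_0[OF v(4) ord_v v(6)])
  then have q0: "poly q 0 \<noteq> 0" by (simp add: v(3))
  define z where "z = r ^ (l - 1) \<star> w"
  have "z \<noteq> 0" unfolding z_def by (rule prime_power_pred_act_nonzero[OF w(4) ord_w w(6)])
  then obtain f where f: "functional f" "f z \<noteq> 0" by (rule functional_exists)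
  have small: "N = {0}" if "invariant N" "N \<subseteq> U'" "\<And>y. y \<in> N \<Longrightarrow> f y = 0" for N
    using socle_in_invariant_subspace[OF w(4) ord_w that(1)] that(2,3) f(2) unfolding w(1) z_def by blast
  have adj_q: "adj q y = 0" if y: "y \<in> U'" for y
  proof -
    obtain h where "y = h \<star> w" using y w(1) by blast
    then have "dual_poly J q \<star> y = h \<star> dual_poly J q \<star> w" by (simp add: act_commute)
    also have "\<dots> = 0" using has_orderD[OF w(2), of "dual_poly J q"] by simp
    finally show ?thesis using adj_eq_0_iff[OF q0] by simp
  qed
  define B where "B u y = f (adj (SOME g. u = g \<star> v) y)" for u y
  have B: "B (g \<star> v) y = f (adj g y)" if "y \<in> U'" for g y
  proof -
    define h where "h = (SOME h. g \<star> v = h \<star> v)"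
    have "g \<star> v = h \<star> v" unfolding h_def by (rule someI_ex) blast
    then have "q dvd g - h" using has_orderD[OF v(2), of "g - h"] by (simp add: act_diff_left)
    then obtain c where "g - h = c * q" unfolding dvd_def by (metis mult.commute)
    then have "adj g y - adj h y = 0"
      using adj_q[OF that] adj_diff_left[of g h y] adj_0 by (simp add: adj_mult) (simp add: adj_def)
    then show ?thesis by (simp add: B_def h_def[symmetric])
  qed
  have B_add_left: "B (u + u') y = B u y + B u' y" if uy: "u \<in> U" "u' \<in> U" "y \<in> U'" for u u' y
  proof -
    obtain g g' where g: "u = g \<star> v" "u' = g' \<star> v" using uy v(1) by blast
    show ?thesis
      unfolding g act_add_left[symmetric] B[OF that(3)] by (simp add: adj_add_left functional_add[OF f(1)])
  qed
  have B_scale_left: "B (a *s u) y = J a * B u y" if uy: "u \<in> U" "y \<in> U'" for a u y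
  proof -
    obtain g where g: "u = g \<star> v" using uy v(1) by blast
    show ?thesis
      unfolding g act_smult[symmetric] B[OF that(2)] by (simp add: adj_smult functional_scale[OF f(1)])
  qed
  have B_right: "B u (y + y') = B u y + B u y'" "B u (a *s y) = a * B u y" for u y y' a
    unfolding B_def by (simp_all add: adj_add adj_scale functional_add[OF f(1)] functional_scale[OF f(1)])
  have B_T: "B (T u) (T y) = B u y" if uy: "u \<in> U" "y \<in> U'" for u y
  proof -
    obtain g where g: "u = g \<star> v" using uy v(1) by blast
    have "T u = ([:0, 1:] * g) \<star> v" unfolding g by (simp add: act_pCons)
    then have "B (T u) (T y) = f (adj ([:0, 1:] * g) (T y))"
      using B[OF invariant_T[OF inv(2) that(2)]] by simp
    also have "\<dots> = f (adj g y)" by (simp only: adj_x adj_T inv_T T_inv)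
    also have "\<dots> = B u y" unfolding g by (rule B[OF that(2), symmetric])
    finally show ?thesis .
  qed
  have right: "{y \<in> U'. \<forall>u\<in>U. B u y = 0} = {0}"
  proof (rule small)
    show "invariant {y \<in> U'. \<forall>u\<in>U. B u y = 0}"
      by (rule radical_invariant[OF inv(2,1), of "\<lambda>y u. B u y" "\<lambda>a. a"]) (simp_all add: B_right B_T)
    fix y assume y: "y \<in> {y \<in> U'. \<forall>u\<in>U. B u y = 0}"
    then have "B (1 \<star> v) y = 0" unfolding v(1) by blast
    then show "f y = 0" using y B[of y 1] adj_pCons[of 1 0 y] by (simp add: one_pCons inverse.T_zero)
  qed auto
  have left: "{u \<in> U. \<forall>y\<in>U'. B u y = 0} = {0}"
  proof (rule ccontr)
    assume ne: "{u \<in> U. \<forall>y\<in>U'. B u y = 0} \<noteq> {0}"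
    have "invariant {u \<in> U. \<forall>y\<in>U'. B u y = 0}"
      by (rule radical_invariant[OF inv, of B J]) (simp_all add: B_add_left B_scale_left B_T)
    from socle_in_invariant_subspace[OF v(4) ord_v this _ ne]
    have "\<forall>y\<in>U'. B (p ^ (k - 1) \<star> v) y = 0" unfolding v(1) by blast
    then have zero: "f (adj (p ^ (k - 1)) y) = 0" if "y \<in> U'" for y
      using that B by simp
    have "adj (p ^ (k - 1)) ` U' = {0}"
    proof (rule small)
      have sub: "subspace U'" by (rule invariant_subspaceD[OF inv(2)])
      show "invariant (adj (p ^ (k - 1)) ` U')"
        unfolding invariant_subspace_def
      proof
        show "subspace (adj (p ^ (k - 1)) ` U')"
        proof (rule subspaceI)
          show "0 \<in> adj (p ^ (k - 1)) ` U'"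
            using subspace_0[OF sub] adj_scale[of "p ^ (k - 1)" 0 0] by (metis image_eqI scale_zero_left)
        next
          fix x y assume "x \<in> adj (p ^ (k - 1)) ` U'" "y \<in> adj (p ^ (k - 1)) ` U'"
          then show "x + y \<in> adj (p ^ (k - 1)) ` U'"
            using subspace_add[OF sub] by (auto simp: adj_add[symmetric])
        next
          fix c x assume "x \<in> adj (p ^ (k - 1)) ` U'"
          then show "c *s x \<in> adj (p ^ (k - 1)) ` U'"
            using subspace_scale[OF sub] by (auto simp: adj_scale[symmetric])
        qed
        show "T ` adj (p ^ (k - 1)) ` U' \<subseteq> adj (p ^ (k - 1)) ` U'"
          using invariant_T[OF inv(2)] by (auto simp: adj_T[symmetric])
      qed
      show "adj (p ^ (k - 1)) ` U' \<subseteq> U'" using invariant_adj[OF inv(2)] by blast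
    qed (use zero in auto)
    moreover have "w \<in> U'" unfolding w(1) by (rule generator_in_cyc)
    ultimately have "adj (p ^ (k - 1)) w = 0" by blast
    then have "dual_poly J q dvd dual_poly J (p ^ (k - 1))"
      using adj_eq_0_iff[of "p ^ (k - 1)" w] p0 has_orderD[OF w(2)] by simp
    moreover have "dual_poly J (p ^ (k - 1)) \<noteq> 0"
      using monic_dual[of "p ^ (k - 1)"] p0 by auto
    ultimately have "degree (dual_poly J q) \<le> degree (dual_poly J (p ^ (k - 1)))"
      by (rule dvd_imp_degree_le)
    then have "degree (p ^ k) \<le> degree (p ^ (k - 1))"
      using degree_dual[OF q0] degree_dual[of "p ^ (k - 1)"] p0 by (simp add: v(3))
    moreover have "p \<noteq> 0" using v(4) by auto
    ultimately have "k * degree p \<le> (k - 1) * degree p" by (simp add: degree_power_eq)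
    then show False using irreducible_poly_degree_pos[OF v(4)] v(6) by simp
  qed
  have "pairing U U' B"
    unfolding pairing_def
  proof (intro conjI)
    show "\<forall>u\<in>U. (\<forall>y\<in>U'. B u y = 0) \<longrightarrow> u = 0" using left by blast
    show "\<forall>y\<in>U'. (\<forall>u\<in>U. B u y = 0) \<longrightarrow> y = 0" using right by blast
  qed (simp_all add: B_add_left B_scale_left B_right B_T)
  then show ?thesis by blast
qed

definition hermitian_on :: "'b set \<Rightarrow> ('b \<Rightarrow> 'b \<Rightarrow> 'a) \<Rightarrow> bool" where
  "hermitian_on W H \<longleftrightarrow>
     (\<forall>u\<in>W. \<forall>u'\<in>W. \<forall>v\<in>W. H (u + u') v = H u v + H u' v) \<and>
     (\<forall>a. \<forall>u\<in>W. \<forall>v\<in>W. H (a *s u) v = J a * H u v) \<and>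
     (\<forall>u\<in>W. \<forall>v\<in>W. H u v = J (H v u)) \<and>
     (\<forall>u\<in>W. \<forall>v\<in>W. H (T u) (T v) = H u v) \<and>
     (\<forall>u\<in>W. (\<forall>v\<in>W. H u v = 0) \<longrightarrow> u = 0)"

lemma hermitian_onI:
  assumes "\<And>u u' v. u \<in> W \<Longrightarrow> u' \<in> W \<Longrightarrow> v \<in> W \<Longrightarrow> H (u + u') v = H u v + H u' v"
    and "\<And>a u v. u \<in> W \<Longrightarrow> v \<in> W \<Longrightarrow> H (a *s u) v = J a * H u v"
    and "\<And>u v. u \<in> W \<Longrightarrow> v \<in> W \<Longrightarrow> H u v = J (H v u)"
    and "\<And>u v. u \<in> W \<Longrightarrow> v \<in> W \<Longrightarrow> H (T u) (T v) = H u v"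
    and "\<And>u. u \<in> W \<Longrightarrow> \<forall>v\<in>W. H u v = 0 \<Longrightarrow> u = 0"
  shows "hermitian_on W H"
  unfolding hermitian_on_def by (intro conjI allI ballI impI) (fact assms)+

lemma hermitian_onD:
  assumes "hermitian_on W H"
  shows "u \<in> W \<Longrightarrow> u' \<in> W \<Longrightarrow> v \<in> W \<Longrightarrow> H (u + u') v = H u v + H u' v"
    and "u \<in> W \<Longrightarrow> v \<in> W \<Longrightarrow> H (a *s u) v = J a * H u v"
    and "u \<in> W \<Longrightarrow> v \<in> W \<Longrightarrow> H u v = J (H v u)"
    and "u \<in> W \<Longrightarrow> v \<in> W \<Longrightarrow> H (T u) (T v) = H u v"
    and "u \<in> W \<Longrightarrow> (\<And>v. v \<in> W \<Longrightarrow> H u v = 0) \<Longrightarrow> u = 0"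
  using assms unfolding hermitian_on_def by blast+

lemma pairingD:
  assumes "pairing U W B"
  shows "u \<in> U \<Longrightarrow> u' \<in> U \<Longrightarrow> v \<in> W \<Longrightarrow> B (u + u') v = B u v + B u' v"
    and "u \<in> U \<Longrightarrow> v \<in> W \<Longrightarrow> v' \<in> W \<Longrightarrow> B u (v + v') = B u v + B u v'"
    and "u \<in> U \<Longrightarrow> v \<in> W \<Longrightarrow> B (a *s u) v = J a * B u v"
    and "u \<in> U \<Longrightarrow> v \<in> W \<Longrightarrow> B u (a *s v) = a * B u v"
    and "u \<in> U \<Longrightarrow> v \<in> W \<Longrightarrow> B (T u) (T v) = B u v"
    and "u \<in> U \<Longrightarrow> (\<And>v. v \<in> W \<Longrightarrow> B u v = 0) \<Longrightarrow> u = 0"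
    and "v \<in> W \<Longrightarrow> (\<And>u. u \<in> U \<Longrightarrow> B u v = 0) \<Longrightarrow> v = 0"
  using assms[unfolded pairing_def] by simp_all

text \<open>For every scalar \<open>d\<close> the form \<open>d B(x, y) + (d B(y, x))\<^sup>J\<close> is hermitian and invariant. If it were
  degenerate both for \<open>d = 1\<close> and for \<open>d = c\<close>, the two radicals would share the minimal
  invariant subspace. Adding the two vanishing conditions, the second one divided by \<open>c\<close>, gives
  \<open>2 B s y = 0\<close> for a generator \<open>s\<close> of it and all \<open>y\<close>, against the non-degeneracy of \<open>B\<close>.\<close>

lemma self_pairing_imp_hermitian:
  assumes U: "primary_cyclic U q" and B: "pairing U U B"
    and c: "c \<noteq> 0" "J c = - c" and two: "(2::'a) \<noteq> 0"
  shows "\<exists>H. hermitian_on U H"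
proof (rule ccontr)
  assume no: "\<nexists>H. hermitian_on U H"
  have inv: "invariant U" by (rule primary_cyclic_invariant[OF U])
  obtain v p k where v: "U = cyc v" "has_order v (p ^ k)" "irreducible p" "0 < k"
    using U unfolding primary_cyclic_def by blast
  define s where "s = p ^ (k - 1) \<star> v"
  have s: "s \<in> U" "s \<noteq> 0"
    using prime_power_pred_act_nonzero[OF v(3,2,4)] unfolding s_def v(1) by blast+
  define H where "H d x y = d * B x y + J d * J (B y x)" for d x y
  have add: "H d (x + x') y = H d x y + H d x' y" if "x \<in> U" "x' \<in> U" "y \<in> U" for d x x' y
    using that by (simp add: H_def pairingD(1,2)[OF B] J_add algebra_simps)
  have scale: "H d (a *s x) y = J a * H d x y" if "x \<in> U" "y \<in> U" for d a x y
    using that by (simp add: H_def pairingD(3,4)[OF B] J_mult algebra_simps)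
  have herm: "H d x y = J (H d y x)" for d x y
    by (simp add: H_def J_add J_mult add.commute)
  have T: "H d (T x) (T y) = H d x y" if "x \<in> U" "y \<in> U" for d x y
    using that by (simp add: H_def pairingD(5)[OF B])
  have "H d s y = 0" if y: "y \<in> U" for d y
  proof -
    have "\<not> (\<forall>x\<in>U. (\<forall>y\<in>U. H d x y = 0) \<longrightarrow> x = 0)"
    proof
      assume nondeg: "\<forall>x\<in>U. (\<forall>y\<in>U. H d x y = 0) \<longrightarrow> x = 0"
      have "hermitian_on U (H d)"
        unfolding hermitian_on_def
      proof (intro conjI)
        show "\<forall>x\<in>U. \<forall>y\<in>U. H d x y = J (H d y x)" using herm by blast
      qed (use add scale T nondeg in blast)+
      then show False using no by blast
    qed
    then have ne: "{x \<in> U. \<forall>y\<in>U. H d x y = 0} \<noteq> {0}" by blast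
    have "invariant {x \<in> U. \<forall>y\<in>U. H d x y = 0}"
      by (rule radical_invariant[OF inv inv, of "H d" J]) (simp_all add: add scale T)
    from socle_in_invariant_subspace[OF v(3,2) this _ ne]
    show ?thesis using y unfolding s_def v(1) by blast
  qed
  \<comment> \<open>The cases \<open>d = 1\<close> and \<open>d = c\<close>.\<close>
  then have eqs: "B s y + J (B y s) = 0" "c * B s y - c * J (B y s) = 0" if "y \<in> U" for y
    using that c(2) unfolding H_def by (metis J_1 mult_1, metis add_uminus_conv_diff mult_minus_left)
  have "B s y = 0" if "y \<in> U" for y
  proof -
    have "c * (B s y - J (B y s)) = 0" using eqs(2)[OF that] by (simp add: algebra_simps)
    then have "B s y = J (B y s)" using c(1) by simp
    then have "2 * B s y = 0" using eqs(1)[OF that] by simp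
    then show ?thesis using two by simp
  qed
  then show False using pairingD(6)[OF B s(1)] s(2) by blast
qed

lemma projections_exist:
  assumes "invariant U" "invariant W" "U \<inter> W = {0}"
  obtains P Q where "\<forall>u\<in>U. \<forall>w\<in>W. P (u + w) = u" "\<forall>u\<in>U. \<forall>w\<in>W. Q (u + w) = w"
proof -
  define P where "P x = (THE u. u \<in> U \<and> (\<exists>w\<in>W. x = u + w))" for x
  have P: "P (u + w) = u" if "u \<in> U" "w \<in> W" for u w
    unfolding P_def using that set_sum_unique(1)[OF assms] by (intro the_equality) blast+
  moreover have "(u + w) - P (u + w) = w" if "u \<in> U" "w \<in> W" for u w
    using P[OF that] by simp
  ultimately show thesis using that[of P "\<lambda>x. x - P x"] by blast
qed

lemma hermitian_on_sum:
  assumes U: "invariant U" and W: "invariant W" and int: "U \<inter> W = {0}"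
    and H: "hermitian_on U H" and K: "hermitian_on W K"
  shows "\<exists>L. hermitian_on (U \<boxplus> W) L"
proof -
  obtain P Q where P: "\<forall>u\<in>U. \<forall>w\<in>W. P (u + w) = u" and Q: "\<forall>u\<in>U. \<forall>w\<in>W. Q (u + w) = w"
    by (rule projections_exist[OF U W int])
  define L where "L x y = H (P x) (P y) + K (Q x) (Q y)" for x y
  have L: "L (u + w) (u' + w') = H u u' + K w w'" if "u \<in> U" "w \<in> W" "u' \<in> U" "w' \<in> W" for u w u' w'
    using that by (simp add: L_def P Q)
  have "hermitian_on (U \<boxplus> W) L"
  proof (rule hermitian_onI)
    show "L (x + x') y = L x y + L x' y" if xy: "x \<in> U \<boxplus> W" "x' \<in> U \<boxplus> W" "y \<in> U \<boxplus> W" for x x' y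
    proof -
      obtain u w u' w' u2 w2 where *: "x = u + w" "x' = u' + w'" "y = u2 + w2"
        "u \<in> U" "w \<in> W" "u' \<in> U" "w' \<in> W" "u2 \<in> U" "w2 \<in> W" using xy by blast
      have eq: "x + x' = (u + u') + (w + w')" by (simp add: *(1,2))
      then show ?thesis
        using *(4-9) by (simp only: *(3) eq L invariant_add[OF U] invariant_add[OF W])
          (simp add: *(1,2) L hermitian_onD(1)[OF H] hermitian_onD(1)[OF K])
    qed
    show "L (a *s x) y = J a * L x y" if xy: "x \<in> U \<boxplus> W" "y \<in> U \<boxplus> W" for a x y
    proof -
      obtain u w u2 w2 where *: "x = u + w" "y = u2 + w2" "u \<in> U" "w \<in> W" "u2 \<in> U" "w2 \<in> W"
        using xy by blast
      then show ?thesis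
        by (simp add: L invariant_scale[OF U] invariant_scale[OF W] scale_right_distrib distrib_left
            hermitian_onD(2)[OF H] hermitian_onD(2)[OF K])
    qed
    show "L x y = J (L y x)" if xy: "x \<in> U \<boxplus> W" "y \<in> U \<boxplus> W" for x y
    proof -
      obtain u w u2 w2 where *: "x = u + w" "y = u2 + w2" "u \<in> U" "w \<in> W" "u2 \<in> U" "w2 \<in> W"
        using xy by blast
      have "H u u2 = J (H u2 u)" "K w w2 = J (K w2 w)"
        using hermitian_onD(3)[OF H] hermitian_onD(3)[OF K] * by blast+
      then show ?thesis using *(3-6) by (simp add: *(1,2) L J_add)
    qed
    show "L (T x) (T y) = L x y" if xy: "x \<in> U \<boxplus> W" "y \<in> U \<boxplus> W" for x y
    proof -
      obtain u w u2 w2 where *: "x = u + w" "y = u2 + w2" "u \<in> U" "w \<in> W" "u2 \<in> U" "w2 \<in> W"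
        using xy by blast
      then show ?thesis
        by (simp add: L invariant_T[OF U] invariant_T[OF W] T_add hermitian_onD(4)[OF H] hermitian_onD(4)[OF K])
    qed
    show "x = 0" if x: "x \<in> U \<boxplus> W" "\<forall>y\<in>U \<boxplus> W. L x y = 0" for x
    proof -
      obtain u w where *: "x = u + w" "u \<in> U" "w \<in> W" using x(1) by blast
      have 0: "0 \<in> U" "0 \<in> W" using U W zero_in_invariant by auto
      have zero: "K w 0 = 0" "H u 0 = 0"
      proof -
        have "K 0 w = 0" "H 0 u = 0"
          using hermitian_onD(2)[OF H 0(1) *(2), of 0] hermitian_onD(2)[OF K 0(2) *(3), of 0] by simp_all
        then show "K w 0 = 0" "H u 0 = 0"
          using hermitian_onD(3)[OF H *(2) 0(1)] hermitian_onD(3)[OF K *(3) 0(2)] by simp_all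
      qed
      have "H u y = 0" if "y \<in> U" for y
      proof -
        have "y \<in> U \<boxplus> W" using set_sum_superset(1)[OF U W] that by blast
        then show ?thesis using x(2) L[OF *(2,3) that 0(2)] zero(1) *(1) by simp
      qed
      moreover have "K w y = 0" if "y \<in> W" for y
      proof -
        have "y \<in> U \<boxplus> W" using set_sum_superset(2)[OF U W] that by blast
        then show ?thesis using x(2) L[OF *(2,3) 0(1) that] zero(2) *(1) by simp
      qed
      ultimately have "u = 0" "w = 0" using hermitian_onD(5)[OF H *(2)] hermitian_onD(5)[OF K *(3)] by blast+
      then show "x = 0" using *(1) by simp
    qed
  qed
  then show ?thesis by blast
qed

text \<open>The hyperbolic form: both summands are totally isotropic, and \<open>B\<close> pairs them.\<close>

lemma pairing_imp_hermitian_on_sum: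
  assumes U: "invariant U" and W: "invariant W" and int: "U \<inter> W = {0}"
    and B: "pairing U W B"
  shows "\<exists>L. hermitian_on (U \<boxplus> W) L"
proof -
  obtain P Q where P: "\<forall>u\<in>U. \<forall>w\<in>W. P (u + w) = u" and Q: "\<forall>u\<in>U. \<forall>w\<in>W. Q (u + w) = w"
    by (rule projections_exist[OF U W int])
  define L where "L x y = B (P x) (Q y) + J (B (P y) (Q x))" for x y
  have L: "L (u + w) (u' + w') = B u w' + J (B u' w)" if "u \<in> U" "w \<in> W" "u' \<in> U" "w' \<in> W" for u w u' w'
    using that by (simp add: L_def P Q)
  have "hermitian_on (U \<boxplus> W) L"
  proof (rule hermitian_onI)
    show "L (x + x') y = L x y + L x' y" if xy: "x \<in> U \<boxplus> W" "x' \<in> U \<boxplus> W" "y \<in> U \<boxplus> W" for x x' y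
    proof -
      obtain u w u' w' u2 w2 where *: "x = u + w" "x' = u' + w'" "y = u2 + w2"
        "u \<in> U" "w \<in> W" "u' \<in> U" "w' \<in> W" "u2 \<in> U" "w2 \<in> W" using xy by blast
      have eq: "x + x' = (u + u') + (w + w')" by (simp add: *(1,2))
      then show ?thesis
        using *(4-9) by (simp only: *(3) eq L invariant_add[OF U] invariant_add[OF W])
          (simp add: *(1,2) L pairingD(1,2)[OF B] J_add)
    qed
    show "L (a *s x) y = J a * L x y" if xy: "x \<in> U \<boxplus> W" "y \<in> U \<boxplus> W" for a x y
    proof -
      obtain u w u2 w2 where *: "x = u + w" "y = u2 + w2" "u \<in> U" "w \<in> W" "u2 \<in> U" "w2 \<in> W"
        using xy by blast
      then show ?thesis
        by (simp add: L invariant_scale[OF U] invariant_scale[OF W] scale_right_distrib distrib_left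
            pairingD(3,4)[OF B] J_mult)
    qed
    show "L x y = J (L y x)" for x y
      by (simp add: L_def J_add add.commute)
    show "L (T x) (T y) = L x y" if xy: "x \<in> U \<boxplus> W" "y \<in> U \<boxplus> W" for x y
    proof -
      obtain u w u2 w2 where *: "x = u + w" "y = u2 + w2" "u \<in> U" "w \<in> W" "u2 \<in> U" "w2 \<in> W"
        using xy by blast
      then show ?thesis
        by (simp add: L invariant_T[OF U] invariant_T[OF W] T_add pairingD(5)[OF B])
    qed
    show "x = 0" if x: "x \<in> U \<boxplus> W" "\<forall>y\<in>U \<boxplus> W. L x y = 0" for x
    proof -
      obtain u w where *: "x = u + w" "u \<in> U" "w \<in> W" using x(1) by blast
      have 0: "0 \<in> U" "0 \<in> W" using U W zero_in_invariant by auto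
      have zero: "B u 0 = 0" "B 0 w = 0"
        using pairingD(3)[OF B 0(1) *(3), of 0] pairingD(4)[OF B *(2) 0(2), of 0] by simp_all
      have "B u y = 0" if "y \<in> W" for y
      proof -
        have "y \<in> U \<boxplus> W" using set_sum_superset(2)[OF U W] that by blast
        then show ?thesis using x(2) L[OF *(2,3) 0(1) that] zero(2) *(1) by simp
      qed
      moreover have "B y w = 0" if "y \<in> U" for y
      proof -
        have "y \<in> U \<boxplus> W" using set_sum_superset(1)[OF U W] that by blast
        then show ?thesis using x(2) L[OF *(2,3) that 0(2)] zero(1) *(1) by simp
      qed
      ultimately have "u = 0" "w = 0" using pairingD(6)[OF B *(2)] pairingD(7)[OF B *(3)] by blast+
      then show "x = 0" using *(1) by simp
    qed
  qed
  then show ?thesis by blast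
qed

end

section \<open>Forms from decompositions closed under duality\<close>

text \<open>The induction step of the construction below: the orbits of \<open>D\<close> have one or two elements, and a
  whole orbit is removed at a time.\<close>

lemma count_invariant_remove:
  assumes "\<And>x. x \<in># M \<Longrightarrow> D (D x) = x" and "\<And>x. x \<in># M \<Longrightarrow> count M (D x) = count M x"
    and q: "q \<in># M"
    and N: "N = (if D q = q then M - {#q#} else M - {#q, D q#})"
    and x: "x \<in># N"
  shows "count N (D x) = count N x"
proof -
  have "x \<in># M" using x unfolding N by (auto split: if_splits dest: in_diffD)
  then have "D x = q \<longleftrightarrow> x = D q" "D x = D q \<longleftrightarrow> x = q" "count M (D x) = count M x"
    using assms(1,2) q by metis+
  then show ?thesis unfolding N by auto
qed

context invertible_endo begin

lemma elementary_divisor_dual_dual: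
  assumes "primary_decomp W M" "q \<in># M"
  shows "dual_poly J (dual_poly J q) = q"
proof -
  obtain v p k where "v \<in> W" "has_order v q" "q = p ^ k" "irreducible p" "monic p" "0 < k"
    by (rule primary_decomp_element[OF assms])
  moreover from this have "poly p 0 \<noteq> 0"
    using prime_factor_nonzero_at_0[of p v k] by simp
  ultimately show ?thesis
    using dual_dual[of q] by (simp add: monic_power)
qed

text \<open>Self-dual divisors satisfy the equality of multiplicities trivially, so the case distinction in the
  definition can be dropped.\<close>

lemma closed_under_dual_iff_count:
  "elementary_divisors_closed_under_dual J M \<longleftrightarrow> (\<forall>q. q \<in># M \<longrightarrow> count M (dual_poly J q) = count M q)"
  unfolding elementary_divisors_closed_under_dual_def self_dual_def
  by (metis count_greater_zero_iff)

lemma primary_decomp_empty: "primary_decomp W {#} \<Longrightarrow> W = {0}"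
  by (erule primary_decomp.cases) auto

text \<open>Split off one summand when its divisor is self-dual, and otherwise a pair of summands with dual
  divisors; what remains is again closed under duality.\<close>

theorem closed_under_dual_imp_form:
  assumes "primary_decomp W M" and "\<And>q. q \<in># M \<Longrightarrow> count M (dual_poly J q) = count M q"
    and c: "c \<noteq> 0" "J c = - c" and two: "(2::'a) \<noteq> 0"
  shows "\<exists>H. hermitian_on W H"
  using assms(1,2)
proof (induction "size M" arbitrary: W M rule: less_induct)
  case less
  let ?D = "dual_poly J"
  show ?case
  proof (cases "M = {#}")
    case True
    then have "W = {0}" using less.prems(1) primary_decomp_empty by blast
    then have "hermitian_on W (\<lambda>_ _. 0)" by (intro hermitian_onI) auto
    then show ?thesis by blast
  next
    case False
    then obtain q where q: "q \<in># M" by blast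
    obtain U V where UV: "primary_cyclic U q" "primary_decomp V (M - {#q#})" "U \<inter> V = {0}" "W = U \<boxplus> V"
      by (rule primary_decomp_remove[OF less.prems(1) q])
    note invU = primary_cyclic_invariant[OF UV(1)]
    note DD = elementary_divisor_dual_dual[OF less.prems(1)]
    show ?thesis
    proof (cases "?D q = q")
      case True
      obtain B where B: "pairing U U B" using pairing_exists[OF UV(1)] UV(1) True by auto
      obtain H where H: "hermitian_on U H"
        using self_pairing_imp_hermitian[OF UV(1) B c two] by blast
      have "size (M - {#q#}) < size M" using q by (simp add: size_Diff1_less)
      moreover have "count (M - {#q#}) (?D x) = count (M - {#q#}) x" if "x \<in># M - {#q#}" for x
        by (rule count_invariant_remove[OF DD less.prems(2) q _ that]) (simp_all add: True)
      ultimately obtain K where K: "hermitian_on V K"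
        using less.hyps[OF _ UV(2)] by blast
      show ?thesis unfolding UV(4) by (rule hermitian_on_sum[OF invU primary_decomp_invariant[OF UV(2)] UV(3) H K])
    next
      case False
      have "?D q \<in># M" using less.prems(2)[OF q] q by (metis count_greater_zero_iff)
      then have "?D q \<in># M - {#q#}" using False by (simp add: in_diff_count)
      then obtain U' V' where UV': "primary_cyclic U' (?D q)" "primary_decomp V' (M - {#q#} - {#?D q#})"
          "U' \<inter> V' = {0}" "V = U' \<boxplus> V'"
        by (rule primary_decomp_remove[OF UV(2)])
      note invU' = primary_cyclic_invariant[OF UV'(1)] and invV' = primary_decomp_invariant[OF UV'(2)]
      have M': "M - {#q#} - {#?D q#} = M - {#q, ?D q#}" by (simp add: add_mset_commute)
      note disj = direct_sum_assoc_disjoint[OF invU invU' invV' UV'(3) UV(3)[unfolded UV'(4)]]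
      obtain B where B: "pairing U U' B" using pairing_exists[OF UV(1) UV'(1)] by blast
      obtain H where H: "hermitian_on (U \<boxplus> U') H"
        using pairing_imp_hermitian_on_sum[OF invU invU' disj(1) B] by blast
      have "size (M - {#q, ?D q#}) < size M"
        using q by (metis M' diff_subset_eq_self dual_order.strict_trans2 size_Diff1_less size_mset_mono)
      moreover have "count (M - {#q, ?D q#}) (?D x) = count (M - {#q, ?D q#}) x"
        if "x \<in># M - {#q, ?D q#}" for x
        by (rule count_invariant_remove[OF DD less.prems(2) q _ that]) (simp_all add: False)
      ultimately obtain K where K: "hermitian_on V' K"
        using less.hyps[OF _ UV'(2)] unfolding M' by blast
      show ?thesis
        unfolding UV(4) UV'(4) set_sum_assoc
        by (rule hermitian_on_sum[OF invariant_sum[OF invU invU'] invV' disj(2) H K])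
    qed
  qed
qed

lemma hermitian_on_UNIV_imp_form:
  assumes "hermitian_on UNIV H"
  shows "hermitian_form scale J H" "nondegenerate_form H" "invariant_form T H"
proof -
  note H = hermitian_onD[OF assms, simplified]
  have flip: "H u v = J (H v u)" for u v by (rule H(3))
  have "H u (v + v') = H u v + H u v'" for u v v'
    by (subst (1 2 3) flip) (simp add: H(1) J_add)
  moreover have "H (a *s u) (b *s v) = J a * b * H u v" for a b u v
  proof -
    have "H u (b *s v) = b * H u v"
      by (subst (1 2) flip) (simp add: H(2) J_mult)
    then show ?thesis by (simp add: H(2))
  qed
  ultimately have "sesquilinear_form scale J H"
    unfolding sesquilinear_form_def by (intro conjI allI H(1))
  then show "hermitian_form scale J H"
    unfolding hermitian_form_def by (intro conjI allI flip)
  show "nondegenerate_form H"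
    unfolding nondegenerate_form_def
  proof (intro conjI allI impI)
    fix v assume "\<forall>u. H u v = 0"
    then have "\<forall>u. H v u = 0" by (metis flip J_0)
    then show "v = 0" using H(5) by blast
  qed (use H(5) in blast)
  show "invariant_form T H"
    unfolding invariant_form_def using H(4) by blast
qed

lemma skew_hermitian_form_scale:
  assumes "hermitian_form scale J H" "J c = - c"
  shows "skew_hermitian_form scale J (\<lambda>u v. c * H u v)"
proof -
  have herm: "H u v = J (H v u)" for u v
    using assms(1) unfolding hermitian_form_def by blast
  have "sesquilinear_form scale J (\<lambda>u v. c * H u v)"
  proof -
    have "sesquilinear_form scale J H" using assms(1) unfolding hermitian_form_def by blast
    then show ?thesis unfolding sesquilinear_form_def by (simp add: distrib_left)
  qed
  moreover have "c * H u v = - J (c * H v u)" for u v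
    by (subst herm) (simp add: J_mult assms(2))
  ultimately show ?thesis unfolding skew_hermitian_form_def by (intro conjI allI)
qed

section \<open>The eigenvalues 1 and -1\<close>

lemma dual_linear:
  "dual_poly J [:- 1, 1:] = [:- 1, 1:]" "dual_poly J [:1, 1:] = [:1, 1:]"
proof -
  have [simp]: "J (- 1) = - 1" by (simp add: J_minus)
  show "dual_poly J [:- 1, 1:] = [:- 1, 1:]" "dual_poly J [:1, 1:] = [:1, 1:]"
    by (simp_all add: dual_poly_def map_J_pCons reflect_poly_def)
qed

lemma V_o_eq_kernel: "V_o scale T = kernel (char_poly_o scale T) UNIV"
  by (simp add: V_o_def kernel_def)

text \<open>The characteristic polynomial is \<open>r h\<close> with \<open>r = (x - 1)\<^sup>e (x + 1)\<^sup>f\<close> coprime to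
  \<open>h\<close>, and \<open>V\<^sub>o\<close> is the kernel of \<open>h\<close>. By the Cayley-Hamilton theorem the kernel of \<open>r\<close> is a complement.\<close>

lemma V_o_complement:
  assumes two: "(2::'a) \<noteq> 0"
  obtains r where "V_o scale T \<inter> kernel r UNIV = {0}" "V_o scale T \<boxplus> kernel r UNIV = UNIV"
    "\<forall>p. irreducible p \<and> monic p \<and> p dvd r \<longrightarrow> p = [:- 1, 1:] \<or> p = [:1, 1:]"
proof -
  define \<chi> where "\<chi> = char_poly_of scale T"
  have "\<chi> \<noteq> 0" using monic_char_poly_of by (auto simp: \<chi>_def)
  define e where "e = Polynomial.order 1 \<chi>"
  define f where "f = Polynomial.order (- 1) \<chi>"
  define r where "r = [:- 1, 1:] ^ e * [:1, 1::'a:] ^ f"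
  obtain g where g: "\<chi> = [:- 1, 1:] ^ e * g" "\<not> [:- 1, 1:] dvd g"
    using order_decomp[OF \<open>\<chi> \<noteq> 0\<close>, of 1] by (auto simp: e_def)
  have "g \<noteq> 0" using g \<open>\<chi> \<noteq> 0\<close> by auto
  obtain h where h: "g = [:1, 1:] ^ Polynomial.order (- 1) g * h" "\<not> [:1, 1:] dvd h"
    using order_decomp[OF \<open>g \<noteq> 0\<close>, of "- 1"] by auto
  have "poly ([:- 1, 1:] ^ e) (- 1) \<noteq> (0::'a)"
    using two by (simp add: numeral_2_eq_2 poly_power)
  then have "Polynomial.order (- 1) ([:- 1, 1::'a:] ^ e) = 0"
    by (rule order_0I)
  then have "f = Polynomial.order (- 1) g"
    using order_mult[of "[:- 1, 1:] ^ e" g "- 1"] \<open>\<chi> \<noteq> 0\<close> g(1) by (simp add: f_def)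
  then have \<chi>: "\<chi> = r * h" using g(1) h(1) by (simp add: r_def mult.assoc)
  have "r \<noteq> 0" using \<chi> \<open>\<chi> \<noteq> 0\<close> by auto
  then have h_eq: "char_poly_o scale T = h"
    unfolding char_poly_o_def Let_def \<chi>_def[symmetric] e_def[symmetric] f_def[symmetric] r_def[symmetric]
    by (simp add: \<chi>)
  have not_dvd: "\<not> [:- 1, 1:] dvd h" using g(2) h(1) by (metis dvd_mult)
  have factor: "p = [:- 1, 1:] \<or> p = [:1, 1:]" if p: "irreducible p" "monic p" "p dvd r" for p
  proof -
    have lin: "irreducible [:a, 1::'a:]" for a by (rule irreducible_linear_field_poly) simp
    have "p dvd [:- 1, 1:] ^ e \<or> p dvd [:1, 1:] ^ f"
      using p(3) prime_elem_dvd_multD[OF field_poly_irreducible_imp_prime[OF p(1)]] unfolding r_def by blast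
    then show ?thesis
      using monic_irreducible_power_dvd_eq[OF p(1,2) lin] by auto
  qed
  have "coprime r h"
  proof (rule coprimeI, rule ccontr)
    fix d assume d: "d dvd r" "d dvd h" "\<not> is_unit d"
    then have "d \<noteq> 0" using \<open>r \<noteq> 0\<close> by auto
    then have "0 < degree d" using d(3) by (simp add: is_unit_iff_degree)
    then obtain p d' where p: "irreducible p" "d = p * d'" "monic p"
      using irreducible_monic_factor by blast
    then have "p dvd r" "p dvd h" using d by (auto intro: dvd_trans)
    then show False using factor[OF p(1,3)] h(2) not_dvd by blast
  qed
  then obtain s t where st: "s * r + t * h = 1" by (rule coprime_poly_bezout)
  have kill: "(r * h) \<star> v = 0" for v
    using cayley_hamilton[of v] by (simp add: \<chi>_def[symmetric] \<chi>)
  have V: "V_o scale T = kernel h UNIV" by (simp add: V_o_eq_kernel h_eq)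
  have split: "v = s \<star> r \<star> v + t \<star> h \<star> v" for v
    by (metis act_1 act_add_left act_mult st)
  show thesis
  proof (rule that[of r])
    show "V_o scale T \<inter> kernel r UNIV = {0}"
      using split unfolding V by (auto simp: kernel_def) (metis act_0_right add_0)
    show "V_o scale T \<boxplus> kernel r UNIV = UNIV"
    proof -
      have "v \<in> V_o scale T \<boxplus> kernel r UNIV" for v
      proof -
        have "h \<star> s \<star> r \<star> v = s \<star> (r * h) \<star> v" "r \<star> t \<star> h \<star> v = t \<star> (r * h) \<star> v"
          by (simp_all only: act_mult[symmetric] mult_ac)
        then have "s \<star> r \<star> v \<in> V_o scale T" "t \<star> h \<star> v \<in> kernel r UNIV"
          unfolding V by (simp_all add: kernel_def kill)
        then show ?thesis by (subst split) (rule set_sumI)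
      qed
      then show ?thesis by blast
    qed
  qed (use factor in blast)
qed

text \<open>Duality maps the divisors \<open>(x - 1)\<^sup>k\<close> and \<open>(x + 1)\<^sup>k\<close> of the complement to themselves. Hence,
  duality being an involution, the dual of any other divisor is not among them either, and adding the
  divisors of the complement changes no comparison of multiplicities.\<close>

lemma closed_under_dual_V_o:
  assumes two: "(2::'a) \<noteq> 0" and M: "primary_decomp (V_o scale T) M"
  obtains N where "primary_decomp UNIV N"
    "elementary_divisors_closed_under_dual J N \<longleftrightarrow> elementary_divisors_closed_under_dual J M"
proof -
  let ?D = "dual_poly J"
  obtain r where r: "V_o scale T \<inter> kernel r UNIV = {0}" "V_o scale T \<boxplus> kernel r UNIV = UNIV"
    "\<forall>p. irreducible p \<and> monic p \<and> p dvd r \<longrightarrow> p = [:- 1, 1:] \<or> p = [:1, 1:]"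
    by (rule V_o_complement[OF two])
  have "invariant UNIV" by (rule invariantI) auto
  then obtain N where N: "primary_decomp (kernel r UNIV) N"
    using primary_decomp_exists[OF invariant_kernel] by blast
  have UNIV: "primary_decomp UNIV (M + N)" using primary_decomp_sum[OF M N r(1)] unfolding r(2) .
  have self: "?D q = q" if q: "q \<in># N" for q
  proof -
    obtain v p k where v: "v \<in> kernel r UNIV" "has_order v q" "q = p ^ k" "irreducible p" "monic p" "0 < k"
      by (rule primary_decomp_element[OF N q])
    have "p ^ k dvd r" using v(1) has_orderD[OF v(2)] v(3) by (simp add: kernel_def)
    then have "p dvd r" using v(6) by (meson dvd_power dvd_trans)
    then show ?thesis using r(3) v(3-5) dual_linear by (auto simp: dual_power)
  qed
  have "count N (?D q) = count N q" if "q \<in># M + N" for q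
  proof (cases "q \<in># N")
    case False
    have "?D q \<notin># N"
      using False self[of "?D q"] elementary_divisor_dual_dual[OF UNIV that] by auto
    then show ?thesis using False by (simp add: not_in_iff)
  qed (simp add: self)
  then have "elementary_divisors_closed_under_dual J (M + N) \<longleftrightarrow> elementary_divisors_closed_under_dual J M"
    unfolding closed_under_dual_iff_count using self by auto
  then show thesis using that UNIV by blast
qed

theorem invariant_form_iff_closed_under_dual:
  assumes "CHAR('a) \<noteq> 2" "J \<noteq> id"
  shows "(\<exists>H. hermitian_form scale J H \<and> nondegenerate_form H \<and> invariant_form T H) \<longleftrightarrow>
      elementary_divisors_closed_under_dual J (elementary_divisors scale T (V_o scale T))"
    and "(\<exists>H. skew_hermitian_form scale J H \<and> nondegenerate_form H \<and> invariant_form T H) \<longleftrightarrow>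
      elementary_divisors_closed_under_dual J (elementary_divisors scale T (V_o scale T))"
proof -
  obtain c where c: "c \<noteq> 0" "J c = - c" by (rule skew_scalar[OF assms(2)])
  have two: "(2::'a) \<noteq> 0" by (rule two_neq_0[OF assms(1)])
  define M where "M = elementary_divisors scale T (V_o scale T)"
  have "invariant (UNIV :: 'b set)" by (rule invariantI) auto
  then have "\<exists>M. primary_decomp (V_o scale T) M"
    unfolding V_o_eq_kernel by (intro primary_decomp_exists invariant_kernel)
  then have "primary_decomp (V_o scale T) M"
    unfolding M_def elementary_divisors_def is_elementary_divisors_iff_decomp by (rule someI_ex)
  then obtain N where N: "primary_decomp UNIV N"
    and closed: "elementary_divisors_closed_under_dual J N \<longleftrightarrow> elementary_divisors_closed_under_dual J M"
    by (rule closed_under_dual_V_o[OF two])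
  have necessary: "elementary_divisors_closed_under_dual J M"
    if "sesquilinear_form scale J H" "nondegenerate_form H" "invariant_form T H" for H
    using form_imp_closed_under_dual[OF that(1,3,2) N] closed by blast
  have sufficient: "\<exists>H. hermitian_form scale J H \<and> nondegenerate_form H \<and> invariant_form T H"
    if "elementary_divisors_closed_under_dual J M"
  proof -
    have "count N (dual_poly J q) = count N q" if "q \<in># N" for q
      using that closed \<open>elementary_divisors_closed_under_dual J M\<close> by (simp add: closed_under_dual_iff_count)
    then obtain H where "hermitian_on UNIV H"
      using closed_under_dual_imp_form[OF N _ c two] by blast
    then show ?thesis using hermitian_on_UNIV_imp_form by blast
  qed
  show "(\<exists>H. hermitian_form scale J H \<and> nondegenerate_form H \<and> invariant_form T H) \<longleftrightarrow>
      elementary_divisors_closed_under_dual J (elementary_divisors scale T (V_o scale T))"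
    unfolding M_def[symmetric] using necessary sufficient unfolding hermitian_form_def by blast
  have "\<exists>H. skew_hermitian_form scale J H \<and> nondegenerate_form H \<and> invariant_form T H"
    if M: "elementary_divisors_closed_under_dual J M"
  proof -
    obtain H where H: "hermitian_form scale J H" "nondegenerate_form H" "invariant_form T H"
      using sufficient[OF M] by blast
    have "nondegenerate_form (\<lambda>u v. c * H u v)" "invariant_form T (\<lambda>u v. c * H u v)"
      using H(2,3) c(1) by (simp_all add: nondegenerate_form_def invariant_form_def)
    then show ?thesis using skew_hermitian_form_scale[OF H(1) c(2)] by blast
  qed
  then show "(\<exists>H. skew_hermitian_form scale J H \<and> nondegenerate_form H \<and> invariant_form T H) \<longleftrightarrow>
      elementary_divisors_closed_under_dual J (elementary_divisors scale T (V_o scale T))"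
    unfolding M_def[symmetric] using necessary unfolding skew_hermitian_form_def by blast
qed

end

theorem theorem1p1:
  fixes scale :: "'a::field \<Rightarrow> 'b::ab_group_add \<Rightarrow> 'b"
    and Basis :: "'b set"
    and J :: "'a \<Rightarrow> 'a"
    and T :: "'b \<Rightarrow> 'b"
  assumes "CHAR('a) \<noteq> 2"
    and "involutory_automorphism J" and "J \<noteq> id"
    and "finite_dimensional_vector_space scale Basis"
    and "vector_space.dim scale (UNIV :: 'b set) \<ge> 2"
    and "Vector_Spaces.linear scale scale T" and "bij T"
  shows "((\<exists>H. hermitian_form scale J H \<and> nondegenerate_form H \<and> invariant_form T H) \<longleftrightarrow>
            elementary_divisors_closed_under_dual J (elementary_divisors scale T (V_o scale T))) \<and>
         ((\<exists>H. skew_hermitian_form scale J H \<and> nondegenerate_form H \<and> invariant_form T H) \<longleftrightarrow>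
            elementary_divisors_closed_under_dual J (elementary_divisors scale T (V_o scale T)))"
proof -
  interpret invertible_endo scale Basis T J
    using assms by (intro invertible_endo.intro linear_endo.intro linear_endo_axioms.intro
      involution.intro invertible_endo_axioms.intro)
  show ?thesis
    using invariant_form_iff_closed_under_dual[OF assms(1,3)] by blast
qed

end
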